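(* Let $\mathcal{H}$ be an infinite dimensional Hilbert space, let $m\ge1$ be an integer, let $A_1,\dots,A_m$ be positive bounded operators on $\mathcal{H}$, and let $Z_1,\dots,Z_m$ be bounded operators on $\mathcal{H}$ that are expansive and invertible. Let $\|\cdot\|_\infty$ denote the usual operator norm. Then: (i) for every concave function $f:[0,\infty)\to[0,\infty)$, $$ \left\|f\left(\sum_{i=1}^m Z_i^*A_iZ_i\right) \right\|_\infty \le \left\| \sum_{i=1}^m Z_i^*f(A_i)Z_i \right\|_\infty; $$ (ii) for every convex function $g:[0,\infty)\to[0,\infty)$ with $g(0)=0$, $$ \left\| \sum_{i=1}^m Z_i^*g(A_i)Z_i \right\|_\infty \le \left\| g\left(\sum_{i=1}^m Z_i^*A_iZ_i \right) \right\|_\infty; $$ (iii) for every real $p>1$, $$ \left\| \sum_{i=1}^m Z_i^*A_i^pZ_i \right\|_\infty \le \left\| \left(\sum_{i=1}^m Z_i^*A_iZ_i \right)^p \right\|_\infty. $$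
   Context: "Positive" means positive semidefinite (self-adjoint with $\langle Ah,h\rangle\ge0$ for all $h$). An operator $Z$ is called expansive if $Z^*Z\ge I$. Invertible means having a bounded inverse. Functions of positive operators are defined by the (Borel) functional calculus. *)

theory Defs
  imports "HOL-Analysis.Analysis"
begin

section \<open>Complex Hilbert spaces\<close>

text \<open>
  A complex inner product is laid over the real normed structure of the type; the last axiom
  says that the norm is the one induced by the inner product (so the inner product is positive
  definite).  The inner product is linear in its first argument.
\<close>

class complex_inner_space = real_normed_vector +
  fixes scaleC :: "complex \<Rightarrow> 'a \<Rightarrow> 'a" (infixr \<open>*\<^sub>C\<close> 75)
    and cinner :: "'a \<Rightarrow> 'a \<Rightarrow> complex"
  assumes scaleC_add_right: "c *\<^sub>C (x + y) = c *\<^sub>C x + c *\<^sub>C y"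
    and scaleC_add_left: "(c + d) *\<^sub>C x = c *\<^sub>C x + d *\<^sub>C x"
    and scaleC_scaleC: "c *\<^sub>C d *\<^sub>C x = (c * d) *\<^sub>C x"
    and scaleC_of_real: "complex_of_real r *\<^sub>C x = r *\<^sub>R x"
    and cinner_commute: "cinner x y = cnj (cinner y x)"
    and cinner_add_left: "cinner (x + y) z = cinner x z + cinner y z"
    and cinner_scaleC_left: "cinner (c *\<^sub>C x) y = c * cinner x y"
    and cinner_self: "cinner x x = complex_of_real ((norm x)\<^sup>2)"

class complex_hilbert_space = complex_inner_space + complete_space

global_interpretation complex_vector:
  vector_space "scaleC :: complex \<Rightarrow> 'a \<Rightarrow> 'a::complex_inner_space"
proof
  fix x :: 'a
  show "1 *\<^sub>C x = x"
    using scaleC_of_real[of 1 x] by simp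
qed (simp_all add: scaleC_add_right scaleC_add_left scaleC_scaleC)


section \<open>Bounded operators\<close>

text \<open>
  The type of \<^emph>\<open>real\<close>-linear bounded operators comes with the operator norm, addition and
  composition; the bounded operators on the complex space are its complex-linear members.
\<close>

type_synonym 'a endo = "'a \<Rightarrow>\<^sub>L 'a"

definition bounded_op :: "'a::complex_inner_space endo \<Rightarrow> bool" where
  "bounded_op T \<longleftrightarrow> (\<forall>c x. blinfun_apply T (c *\<^sub>C x) = c *\<^sub>C blinfun_apply T x)"

definition adj :: "'a::complex_hilbert_space endo \<Rightarrow> 'a endo" where
  "adj T = (THE S. \<forall>x y. cinner (blinfun_apply T x) y = cinner x (blinfun_apply S y))"

definition self_adjoint :: "'a::complex_hilbert_space endo \<Rightarrow> bool" where
  "self_adjoint T \<longleftrightarrow> bounded_op T \<and> adj T = T"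

definition positive_op :: "'a::complex_hilbert_space endo \<Rightarrow> bool" where
  "positive_op T \<longleftrightarrow> self_adjoint T \<and>
     (\<forall>x. cinner (blinfun_apply T x) x \<in> \<real> \<and> 0 \<le> Re (cinner (blinfun_apply T x) x))"

definition expansive :: "'a::complex_hilbert_space endo \<Rightarrow> bool" where
  "expansive Z \<longleftrightarrow> positive_op ((adj Z o\<^sub>L Z) - id_blinfun)"

definition invertible_op :: "'a::complex_inner_space endo \<Rightarrow> bool" where
  "invertible_op Z \<longleftrightarrow>
     (\<exists>W. bounded_op W \<and> Z o\<^sub>L W = id_blinfun \<and> W o\<^sub>L Z = id_blinfun)"

definition orth_projection :: "'a::complex_hilbert_space endo \<Rightarrow> bool" where
  "orth_projection P \<longleftrightarrow> self_adjoint P \<and> P o\<^sub>L P = P"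


section \<open>Borel functional calculus of positive operators\<close>

text \<open>
  Projection-valued measures on the Borel subsets of the real line; the values of \<open>E\<close> on sets
  that are not Borel are irrelevant.
\<close>

definition projection_valued_measure ::
    "(real set \<Rightarrow> 'a::complex_hilbert_space endo) \<Rightarrow> bool" where
  "projection_valued_measure E \<longleftrightarrow>
     (\<forall>S\<in>sets borel. orth_projection (E S)) \<and>
     E UNIV = id_blinfun \<and>
     (\<forall>S\<in>sets borel. \<forall>T\<in>sets borel. E (S \<inter> T) = E S o\<^sub>L E T) \<and>
     (\<forall>F. range F \<subseteq> sets borel \<and> disjoint_family F \<longrightarrow>
        (\<forall>x. (\<lambda>n::nat. blinfun_apply (E (F n)) x) sums blinfun_apply (E (\<Union>n. F n)) x))"

text \<open>The finite Borel measure that sends \<open>S\<close> to the inner product of \<open>E S x\<close> with \<open>x\<close>.\<close>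

definition diagonal_measure ::
    "(real set \<Rightarrow> 'a::complex_hilbert_space endo) \<Rightarrow> 'a \<Rightarrow> real measure" where
  "diagonal_measure E x =
     measure_of UNIV (sets borel) (\<lambda>S. ennreal (Re (cinner (blinfun_apply (E S) x) x)))"

text \<open>
  \<open>E\<close> is the spectral measure of \<open>T\<close>: it is boundedly supported and \<open>T\<close> is the integral of the
  identity function against \<open>E\<close>, in the weak sense.  Diagonal matrix entries suffice, because
  they determine an operator on a complex Hilbert space.
\<close>

definition spectral_measure ::
    "'a::complex_hilbert_space endo \<Rightarrow> (real set \<Rightarrow> 'a endo) \<Rightarrow> bool" where
  "spectral_measure T E \<longleftrightarrow>
     projection_valued_measure E \<and>
     (\<exists>r. E {-r..r} = id_blinfun) \<and>
     (\<forall>x. cinner (blinfun_apply T x) x =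
        complex_of_real (\<integral>t. t \<partial>diagonal_measure E x))"

text \<open>
  \<open>fun_calc f T\<close> is \<open>f(T)\<close>, the integral of \<open>f\<close> against the spectral measure of \<open>T\<close>, for a
  positive operator \<open>T\<close> and a function \<open>f\<close> on the half-line \<open>[0,\<infinity>)\<close>.  The spectral measure of
  such a \<open>T\<close> vanishes on the negative half-line; restricting the integral to \<open>{0..}\<close> makes the
  values (and the measurability) of the HOL function \<open>f\<close> at negative arguments irrelevant.
\<close>

definition fun_calc ::
    "(real \<Rightarrow> real) \<Rightarrow> 'a::complex_hilbert_space endo \<Rightarrow> 'a endo" where
  "fun_calc f T =
     (THE B. bounded_op B \<and>
        (\<exists>E. spectral_measure T E \<and>
           (\<forall>x. cinner (blinfun_apply B x) x =
              complex_of_real (set_lebesgue_integral (diagonal_measure E x) {0..} f))))"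

end

theory Submission
  imports Defs
begin

text \<open>
  Write \<open>S\<close> for the sum of the operators \<open>Z\<^sub>i\<^sup>* A\<^sub>i Z\<^sub>i\<close> and \<open>M = \<parallel>S\<parallel>\<close>.  Since \<open>Z\<^sub>i\<close> is onto and
  expansive, every vector \<open>x\<close> is \<open>Z\<^sub>i w\<close> with \<open>\<parallel>w\<parallel> \<le> \<parallel>x\<parallel>\<close>, so that \<open>\<parallel>A\<^sub>i\<parallel> \<le> M\<close>
  (\<open>norm_le_norm_congruence_sum\<close>): all spectra lie in \<open>[0, M]\<close>.  There a concave \<open>f \<ge> 0\<close> lies
  above the line \<open>(f M / M) t\<close>, hence the sum of the \<open>Z\<^sub>i\<^sup>* f(A\<^sub>i) Z\<^sub>i\<close> dominates \<open>(f M / M) S\<close>,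
  whose norm is \<open>f M\<close>; on the other side \<open>\<parallel>f(S)\<parallel> \<le> f M\<close> because \<open>f\<close> is nondecreasing
  (\<open>concave_norm_le\<close>).  For convex \<open>g\<close> with \<open>g 0 = 0\<close> the same chord bounds the sum above by
  \<open>g M\<close>, and a supporting line of \<open>g\<close> at \<open>M\<close> shows \<open>\<parallel>g(S)\<parallel> \<ge> g M\<close> (\<open>convex_norm_le\<close>).  The
  powers are a special case.

  So the functional calculus enters only through affine bounds of \<open>f(T)\<close>
  (\<open>fun_calc_affine_bounds\<close>).  But \<open>f(T)\<close> is defined by a definite description, which means
  something only once the spectral theorem for bounded operators is known, with existence and
  uniqueness; most of the text proves it.  For a symmetric \<open>X\<close>, the projection onto the kernel of
  \<open>\<bar>X\<bar> + X\<close> separates the parts where \<open>X \<le> 0\<close> and \<open>X \<ge> 0\<close> (\<open>ex_splitting\<close>).  Applied to all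
  \<open>T - a\<close> this gives an increasing right-continuous family of projections \<open>E a\<close>, thus a
  Stieltjes measure for each vector, and a Dynkin system argument represents the measures of
  every Borel set by one projection (\<open>ex_represents\<close>).  Conversely, each spectral measure of \<open>T\<close>
  commutes with \<open>T\<close> and therefore with the \<open>E a\<close>, which forces it to agree with \<open>E a\<close> on
  half-lines (\<open>spectral_measure_atMost\<close>).  The operator \<open>f(T)\<close> is a norm-convergent series of
  spectral projections, read off from the binary digits of \<open>f\<close> (\<open>ex_integral_op\<close>).
\<close>

section \<open>The underlying real inner product\<close>

definition rinner :: "'a::complex_inner_space \<Rightarrow> 'a \<Rightarrow> real" where
  "rinner x y = Re (cinner x y)"

lemma rinner_self: "rinner x x = (norm x)\<^sup>2"
  by (simp add: rinner_def cinner_self)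

lemma rinner_commute: "rinner x y = rinner y x"
  by (metis cinner_commute complex_cnj rinner_def complex.sel(1) complex.exhaust_sel)

lemma rinner_add_left: "rinner (x + y) z = rinner x z + rinner y z"
  by (simp add: rinner_def cinner_add_left)

lemma rinner_scaleR_left: "rinner (r *\<^sub>R x) z = r * rinner x z"
  by (simp add: rinner_def cinner_scaleC_left flip: scaleC_of_real)

lemma norm_plus_sqr: "(norm (x + y))\<^sup>2 = (norm x)\<^sup>2 + 2 * rinner x y + (norm y)\<^sup>2"
proof -
  have "rinner (x + y) (x + y) = rinner x x + rinner x y + (rinner y x + rinner y y)"
    by (metis rinner_add_left rinner_commute)
  then show ?thesis
    by (simp add: rinner_self rinner_commute[of y x])
qed

text \<open>Since the norm already satisfies the triangle inequality, the Cauchy-Schwarz inequality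
  is read off from it, rather than the other way round.\<close>

lemma rinner_le_norm: "rinner x y \<le> norm x * norm y"
proof -
  have "(norm (x + y))\<^sup>2 \<le> (norm x + norm y)\<^sup>2"
    by (intro power_mono norm_triangle_ineq norm_ge_zero)
  then show ?thesis
    by (simp add: norm_plus_sqr power2_sum)
qed

lemma abs_rinner_le_norm: "\<bar>rinner x y\<bar> \<le> norm x * norm y"
  using rinner_le_norm[of x y] rinner_le_norm[of "-x" y] rinner_scaleR_left[of "-1" x y] by simp

interpretation rinner: bounded_bilinear rinner
proof
  show "\<exists>K. \<forall>a b. norm (rinner a b) \<le> norm a * norm b * K"
    by (metis abs_rinner_le_norm mult.right_neutral real_norm_def)
qed (metis rinner_add_left rinner_scaleR_left rinner_commute real_scaleR_def)+

lemma norm_minus_sqr: "(norm (x - y))\<^sup>2 = (norm x)\<^sup>2 - 2 * rinner x y + (norm y)\<^sup>2"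
  using norm_plus_sqr[of x "-y"] by (simp add: rinner.minus_right)

lemma parallelogram:
  fixes x y :: "'a::complex_inner_space"
  shows "(norm (x + y))\<^sup>2 + (norm (x - y))\<^sup>2 = 2 * (norm x)\<^sup>2 + 2 * (norm y)\<^sup>2"
  by (simp add: norm_plus_sqr norm_minus_sqr)

lemma rinner_eqI:
  assumes "\<And>z. rinner x z = rinner y z"
  shows "x = y"
proof -
  have "rinner (x - y) (x - y) = 0"
    using assms by (simp add: rinner.diff_left)
  then show ?thesis by (simp add: rinner_self)
qed

lemma scaleC_scaleR: "c *\<^sub>C (r *\<^sub>R x) = r *\<^sub>R (c *\<^sub>C x)"
  by (metis mult.commute scaleC_of_real scaleC_scaleC)

lemma rinner_scaleC_left: "rinner (c *\<^sub>C x) y = rinner x (cnj c *\<^sub>C y)"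
proof -
  have "cinner x (cnj c *\<^sub>C y) = c * cinner x y"
    by (metis cinner_commute cinner_scaleC_left complex_cnj_cnj complex_cnj_mult)
  then show ?thesis by (simp add: rinner_def cinner_scaleC_left)
qed

lemma norm_scaleC: "norm (c *\<^sub>C x) = cmod c * norm x"
proof -
  have "(norm (c *\<^sub>C x))\<^sup>2 = rinner x (cnj c *\<^sub>C c *\<^sub>C x)"
    by (simp flip: rinner_self add: rinner_scaleC_left)
  also have "\<dots> = (cmod c * norm x)\<^sup>2"
    by (simp add: scaleC_scaleC mult.commute[of "cnj c"] scaleC_of_real
        rinner.scaleR_right rinner_self power_mult_distrib
        del: of_real_power flip: complex_norm_square)
  finally show ?thesis by (simp add: power2_eq_iff_nonneg)
qed

lemma bounded_linear_scaleC: "bounded_linear ((*\<^sub>C) c)"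
  by (rule bounded_linear_intro[where K = "cmod c"])
    (simp_all add: scaleC_add_right scaleC_scaleR norm_scaleC mult.commute)

lemma cinner_rinner: "cinner x y = Complex (rinner x y) (- rinner (\<i> *\<^sub>C x) y)"
  by (rule complex_eqI) (simp_all add: rinner_def cinner_scaleC_left)

lemma Re_cinner: "Re (cinner x y) = rinner x y"
  by (simp add: rinner_def)

instance complex_hilbert_space \<subseteq> banach ..


section \<open>Orthogonal projections and adjoints\<close>

text \<open>The point of a closed subspace nearest to \<open>x\<close>: by the parallelogram identity every
  minimising sequence is a Cauchy sequence.\<close>

lemma ex_nearest_point:
  fixes K :: "'a::complex_hilbert_space set"
  assumes K: "subspace K" "closed K"
  shows "\<exists>p\<in>K. \<forall>k\<in>K. norm (x - p) \<le> norm (x - k)"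
proof -
  define D where "D = (\<lambda>k. (norm (x - k))\<^sup>2) ` K"
  define d where "d = Inf D"
  have ne: "D \<noteq> {}" and bdd: "bdd_below D"
    using subspace_0[OF K(1)] by (auto simp: D_def intro!: bdd_belowI2[where m = 0])
  have d_le: "d \<le> (norm (x - k))\<^sup>2" if "k \<in> K" for k
    unfolding d_def using that bdd by (intro cInf_lower) (auto simp: D_def)
  have "\<exists>k\<in>K. (norm (x - k))\<^sup>2 < d + inverse (Suc n)" for n
    using cInf_lessD[OF ne, of "d + inverse (Suc n)"] by (force simp: d_def D_def)
  then obtain k where kK: "\<And>n. k n \<in> K"
    and kd: "\<And>n. (norm (x - k n))\<^sup>2 < d + inverse (Suc n)" by metis
  have close: "(norm (k m - k n))\<^sup>2 \<le> 4 * inverse (Suc N)" if "m \<ge> N" "n \<ge> N" for m n N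
  proof -
    have "(1/2) *\<^sub>R (k m + k n) \<in> K"
      using K(1) kK by (simp add: subspace_add subspace_scale)
    then have "4 * d \<le> 4 * (norm (x - (1/2) *\<^sub>R (k m + k n)))\<^sup>2"
      using d_le by simp
    also have "\<dots> = (norm (2 *\<^sub>R (x - (1/2) *\<^sub>R (k m + k n))))\<^sup>2"
      by (simp add: power_mult_distrib)
    also have "2 *\<^sub>R (x - (1/2) *\<^sub>R (k m + k n)) = (x - k m) + (x - k n)"
      by (simp add: algebra_simps flip: scaleR_add_left) (metis scaleR_2)
    finally have "4 * d \<le> (norm ((x - k m) + (x - k n)))\<^sup>2" .
    moreover have "inverse (real (Suc m)) \<le> inverse (Suc N)" "inverse (real (Suc n)) \<le> inverse (Suc N)"
      using that by (simp_all add: le_imp_inverse_le)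
    moreover have "norm ((x - k m) - (x - k n)) = norm (k m - k n)" by (simp add: norm_minus_commute)
    ultimately show ?thesis
      using parallelogram[of "x - k m" "x - k n"] kd[of m] kd[of n]
      by (smt (verit))
  qed
  have "Cauchy k"
  proof (rule CauchyI)
    fix e :: real assume e: "0 < e"
    obtain N where N: "inverse (real (Suc N)) < e\<^sup>2 / 4"
      using reals_Archimedean[of "e\<^sup>2 / 4"] e by auto
    have "norm (k m - k n) < e" if "m \<ge> N" "n \<ge> N" for m n
    proof -
      have "(norm (k m - k n))\<^sup>2 < e\<^sup>2" using close[OF that] N by simp
      then show ?thesis using e by (simp add: power_less_imp_less_base)
    qed
    then show "\<exists>M. \<forall>m\<ge>M. \<forall>n\<ge>M. norm (k m - k n) < e" by blast
  qed
  then obtain p where p: "k \<longlonglongrightarrow> p"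
    using Cauchy_convergent_iff convergent_def by blast
  have pK: "p \<in> K" using K(2) kK p closed_sequentially by blast
  have "(norm (x - p))\<^sup>2 \<le> d + 0"
  proof (rule LIMSEQ_le)
    show "(\<lambda>n. (norm (x - k n))\<^sup>2) \<longlonglongrightarrow> (norm (x - p))\<^sup>2" by (intro tendsto_intros p)
    show "(\<lambda>n. d + inverse (Suc n)) \<longlonglongrightarrow> d + 0"
      by (intro tendsto_intros LIMSEQ_inverse_real_of_nat)
  qed (use kd less_imp_le in blast)
  then have "norm (x - p) \<le> norm (x - k)" if "k \<in> K" for k
    using d_le[OF that] by (intro power2_le_imp_le[OF _ norm_ge_zero]) linarith
  then show ?thesis using pK by blast
qed

lemma ex_orthogonal_decomp:
  fixes K :: "'a::complex_hilbert_space set"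
  assumes K: "subspace K" "closed K"
  shows "\<exists>p\<in>K. \<forall>k\<in>K. rinner (x - p) k = 0"
proof -
  obtain p where p: "p \<in> K" "\<And>k. k \<in> K \<Longrightarrow> norm (x - p) \<le> norm (x - k)"
    using ex_nearest_point[OF K] by blast
  have "rinner (x - p) k = 0" if k: "k \<in> K" for k
  proof (cases "k = 0")
    case False
    define t where "t = rinner (x - p) k / (norm k)\<^sup>2"
    have "norm (x - p) \<le> norm (x - (p + t *\<^sub>R k))"
      using p k K by (simp add: subspace_add subspace_scale)
    then have "(norm (x - p))\<^sup>2 \<le> (norm ((x - p) - t *\<^sub>R k))\<^sup>2"
      by (simp add: diff_diff_eq)
    then have "2 * (t * rinner (x - p) k) \<le> t\<^sup>2 * (norm k)\<^sup>2"
      by (subst (asm) (2) norm_minus_sqr) (simp add: rinner.scaleR_right power_mult_distrib)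
    moreover have "t * rinner (x - p) k = t\<^sup>2 * (norm k)\<^sup>2"
      using False by (simp add: t_def power2_eq_square)
    ultimately have "t\<^sup>2 * (norm k)\<^sup>2 \<le> 0" by simp
    then have "t = 0" using False by (simp add: mult_le_0_iff)
    then show ?thesis using False by (simp add: t_def)
  qed (simp add: rinner.zero_right)
  then show ?thesis using p by blast
qed

lemma ex_projection:
  fixes K :: "'a::complex_hilbert_space set"
  assumes K: "subspace K" "closed K"
  shows "\<exists>P::'a endo. (\<forall>x. P x \<in> K) \<and> (\<forall>x. \<forall>k\<in>K. rinner (x - P x) k = 0)"
proof -
  obtain p where pK: "\<And>x. p x \<in> K" and orth: "\<And>x k. k \<in> K \<Longrightarrow> rinner (x - p x) k = 0"
    using ex_orthogonal_decomp[OF K] by metis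
  have unique: "p x = q" if q: "q \<in> K" "\<And>k. k \<in> K \<Longrightarrow> rinner (x - q) k = 0" for x q
  proof -
    have "p x - q \<in> K" using pK q K by (simp add: subspace_diff)
    then have "rinner (p x - q) (p x - q) = 0"
      using orth[of "p x - q" x] q(2)[of "p x - q"] by (simp add: rinner.diff_left)
    then show ?thesis by (simp add: rinner_self)
  qed
  have "bounded_linear p"
  proof (rule bounded_linear_intro[where K = 1])
    fix x y
    show "p (x + y) = p x + p y"
      by (rule unique) (use pK K orth[of _ x] orth[of _ y] in
        \<open>auto simp: subspace_add rinner.add_left rinner.diff_left\<close>)
  next
    fix r x
    show "p (r *\<^sub>R x) = r *\<^sub>R p x"
      by (rule unique) (use pK K orth[of _ x] in
        \<open>auto simp: subspace_scale rinner.scaleR_left rinner.diff_left\<close>)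
  next
    fix x
    have "(norm x)\<^sup>2 = (norm ((x - p x) + p x))\<^sup>2" by simp
    also have "\<dots> = (norm (x - p x))\<^sup>2 + (norm (p x))\<^sup>2"
      by (subst norm_plus_sqr) (simp add: orth pK)
    finally have "(norm (p x))\<^sup>2 \<le> (norm x)\<^sup>2" by simp
    then show "norm (p x) \<le> norm x * 1"
      by (auto intro: power2_le_imp_le)
  qed
  then show ?thesis
    by (intro exI[of _ "Blinfun p"]) (simp add: bounded_linear_Blinfun_apply pK orth)
qed

lemma riesz_representation:
  fixes \<phi> :: "'a::complex_hilbert_space \<Rightarrow> real"
  assumes \<phi>: "bounded_linear \<phi>"
  shows "\<exists>z. \<forall>x. \<phi> x = rinner x z"
proof (cases "\<forall>x. \<phi> x = 0")
  case True
  then show ?thesis by (intro exI[of _ 0]) (simp add: rinner.zero_right)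
next
  case False
  then obtain x0 where x0: "\<phi> x0 \<noteq> 0" by blast
  interpret bounded_linear \<phi> by fact
  define K where "K = {x. \<phi> x = 0}"
  have "subspace K" by (auto simp: K_def subspace_def zero add scale)
  moreover have "closed K"
    unfolding K_def by (intro closed_Collect_eq continuous_intros linear_continuous_on \<phi>)
  ultimately obtain P :: "'a endo" where P: "\<And>x. P x \<in> K" "\<And>x k. k \<in> K \<Longrightarrow> rinner (x - P x) k = 0"
    using ex_projection by metis
  define u where "u = x0 - P x0"
  have u: "\<phi> u = \<phi> x0" using P(1)[of x0] by (simp add: u_def K_def diff)
  then have "u \<noteq> 0" using x0 zero by auto
  have "\<phi> x = rinner x ((\<phi> u / (norm u)\<^sup>2) *\<^sub>R u)" for x
  proof -
    have "x - (\<phi> x / \<phi> u) *\<^sub>R u \<in> K" using x0 u by (simp add: K_def diff scale)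
    then have "rinner u (x - (\<phi> x / \<phi> u) *\<^sub>R u) = 0" using P(2) u_def by blast
    then have "rinner x u = (\<phi> x / \<phi> u) * (norm u)\<^sup>2"
      by (simp add: rinner.diff_right rinner.scaleR_right rinner_self rinner_commute)
    then show ?thesis using \<open>u \<noteq> 0\<close> x0 u by (simp add: rinner.scaleR_right)
  qed
  then show ?thesis by blast
qed

lemma ex_real_adjoint:
  fixes T :: "'a::complex_hilbert_space endo"
  shows "\<exists>S::'a endo. \<forall>x y. rinner (T x) y = rinner x (S y)"
proof -
  have "\<exists>z. \<forall>x. rinner (T x) y = rinner x z" for y
    by (rule riesz_representation)
      (intro bounded_linear_compose[OF rinner.bounded_linear_left blinfun.bounded_linear_right])
  then obtain S where S: "\<And>x y. rinner (T x) y = rinner x (S y)" by metis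
  have S': "rinner (S y) x = rinner (T x) y" for x y by (metis S rinner_commute)
  have "bounded_linear S"
  proof (rule bounded_linear_intro[where K = "norm T"])
    show "S (x + y) = S x + S y" for x y
      by (rule rinner_eqI) (simp add: S' rinner.add_left rinner.add_right)
    show "S (r *\<^sub>R x) = r *\<^sub>R S x" for r x
      by (rule rinner_eqI) (simp add: S' rinner.scaleR_left rinner.scaleR_right)
    show "norm (S x) \<le> norm x * norm T" for x
    proof (cases "S x = 0")
      case False
      have "norm (S x) * norm (S x) = rinner (T (S x)) x"
        by (simp add: S rinner_self flip: power2_eq_square)
      also have "\<dots> \<le> norm (T (S x)) * norm x" by (rule rinner_le_norm)
      also have "\<dots> \<le> (norm T * norm (S x)) * norm x"
        by (intro mult_right_mono norm_blinfun norm_ge_zero)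
      finally show ?thesis using False by (simp add: mult.commute mult.left_commute)
    qed simp
  qed
  then show ?thesis
    by (intro exI[of _ "Blinfun S"]) (simp add: bounded_linear_Blinfun_apply S)
qed

lemma bounded_op_scaleC: "bounded_op T \<Longrightarrow> T (c *\<^sub>C x) = c *\<^sub>C T x"
  by (simp add: bounded_op_def)

text \<open>On complex-linear operators adjointness for the real inner product is adjointness for
  the complex one, so that everything below can be done with real quadratic forms.\<close>

lemma cinner_adjointI:
  assumes T: "bounded_op T" and TS: "\<And>x y. rinner (T x) y = rinner x (S y)"
  shows "cinner (T x) y = cinner x (S y)"
  by (simp add: cinner_rinner[of "T x"] cinner_rinner[of x] TS flip: bounded_op_scaleC[OF T])

lemma adj_eqI:
  fixes S T :: "'a::complex_hilbert_space endo"
  assumes "bounded_op T" "\<And>x y. rinner (T x) y = rinner x (S y)"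
  shows "adj T = S"
  unfolding adj_def
proof (rule the_equality)
  show "\<forall>x y. cinner (T x) y = cinner x (S y)" using cinner_adjointI[OF assms] by blast
  fix S' :: "'a endo" assume "\<forall>x y. cinner (T x) y = cinner x (S' y)"
  then have "rinner (S' y) x = rinner (S y) x" for x y
    using assms(2) by (metis Re_cinner rinner_commute)
  then show "S' = S" by (intro blinfun_eqI rinner_eqI)
qed

lemma rinner_adj_right:
  assumes "bounded_op T"
  shows "rinner x (adj T y) = rinner (T x) y"
  using adj_eqI[OF assms] ex_real_adjoint[of T] by metis

lemma rinner_adj_left:
  assumes "bounded_op T"
  shows "rinner (adj T x) y = rinner x (T y)"
  by (metis assms rinner_adj_right rinner_commute)


section \<open>Symmetric operators\<close>

definition symmetric :: "'a::complex_inner_space endo \<Rightarrow> bool" where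
  "symmetric T \<longleftrightarrow> (\<forall>x y. rinner (T x) y = rinner x (T y))"

lemma symmetricD: "symmetric T \<Longrightarrow> rinner (T x) y = rinner x (T y)"
  by (simp add: symmetric_def)

lemma self_adjoint_iff: "self_adjoint T \<longleftrightarrow> bounded_op T \<and> symmetric T"
  by (metis adj_eqI rinner_adj_right self_adjoint_def symmetric_def)

lemma positive_op_iff:
  "positive_op T \<longleftrightarrow> bounded_op T \<and> symmetric T \<and> (\<forall>x. 0 \<le> rinner (T x) x)"
proof -
  have "cinner (T x) x \<in> \<real>" if "bounded_op T" "symmetric T" for x
  proof -
    have "cinner (T x) x = cnj (cinner (T x) x)"
      using cinner_adjointI[OF that(1)] that(2) by (metis cinner_commute symmetric_def)
    then show ?thesis by (metis Reals_cnj_iff)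
  qed
  then show ?thesis by (auto simp: positive_op_def self_adjoint_iff Re_cinner)
qed

lemma symmetric_zero [simp]: "symmetric 0"
  and symmetric_id [simp]: "symmetric id_blinfun"
  by (simp_all add: symmetric_def rinner.zero_left rinner.zero_right)

lemma symmetric_add: "symmetric S \<Longrightarrow> symmetric T \<Longrightarrow> symmetric (S + T)"
  and symmetric_diff: "symmetric S \<Longrightarrow> symmetric T \<Longrightarrow> symmetric (S - T)"
  and symmetric_scaleR: "symmetric T \<Longrightarrow> symmetric (r *\<^sub>R T)"
  by (simp_all add: symmetric_def blinfun.add_left blinfun.diff_left blinfun.scaleR_left
      rinner.add_left rinner.add_right rinner.diff_left rinner.diff_right
      rinner.scaleR_left rinner.scaleR_right)

lemma bounded_op_zero [simp]: "bounded_op 0"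
  and bounded_op_id [simp]: "bounded_op id_blinfun"
  by (simp_all add: bounded_op_def)

lemma bounded_op_add: "bounded_op S \<Longrightarrow> bounded_op T \<Longrightarrow> bounded_op (S + T)"
  and bounded_op_diff: "bounded_op S \<Longrightarrow> bounded_op T \<Longrightarrow> bounded_op (S - T)"
  and bounded_op_scaleR: "bounded_op T \<Longrightarrow> bounded_op (r *\<^sub>R T)"
  and bounded_op_compose: "bounded_op S \<Longrightarrow> bounded_op T \<Longrightarrow> bounded_op (S o\<^sub>L T)"
  by (simp_all add: bounded_op_def blinfun.add_left blinfun.diff_left blinfun.scaleR_left
      scaleC_add_right scaleC_scaleR complex_vector.scale_right_diff_distrib)

lemma rinner_quadratic_add:
  assumes "symmetric T"
  shows "rinner (T (x + y)) (x + y) = rinner (T x) x + 2 * rinner (T x) y + rinner (T y) y"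
  using symmetricD[OF assms, of x y]
  by (simp add: blinfun.add_right rinner.add_left rinner.add_right rinner_commute[of x])

lemma rinner_quadratic_diff:
  assumes "symmetric T"
  shows "rinner (T (x - y)) (x - y) = rinner (T x) x - 2 * rinner (T x) y + rinner (T y) y"
  using symmetricD[OF assms, of x y]
  by (simp add: blinfun.diff_right rinner.diff_left rinner.diff_right rinner_commute[of x])

lemma symmetric_eqI:
  assumes "symmetric S" "symmetric T" "\<And>x. rinner (S x) x = rinner (T x) x"
  shows "S = T"
proof (intro blinfun_eqI rinner_eqI)
  fix x y
  show "rinner (S x) y = rinner (T x) y"
    using rinner_quadratic_add[OF assms(1), of x y] rinner_quadratic_add[OF assms(2), of x y]
      assms(3)[of x] assms(3)[of y] assms(3)[of "x + y"] by simp
qed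

text \<open>The norm of a symmetric operator is its numerical radius: polarise, and apply the
  parallelogram identity to vectors \<open>x\<close> and \<open>y\<close> of equal length with \<open>y\<close> parallel to \<open>T x\<close>.\<close>

lemma symmetric_norm_le:
  assumes T: "symmetric T" and c: "0 \<le> c" and le: "\<And>x. \<bar>rinner (T x) x\<bar> \<le> c * (norm x)\<^sup>2"
  shows "norm T \<le> c"
proof (rule norm_blinfun_bound[OF c])
  fix x
  show "norm (T x) \<le> c * norm x"
  proof (cases "T x = 0")
    case False
    define y where "y = (norm x / norm (T x)) *\<^sub>R T x"
    have ny: "norm y = norm x" using False by (simp add: y_def)
    have "rinner (T x) y = norm x * norm (T x)"
      using False by (simp add: y_def rinner.scaleR_right rinner_self power2_eq_square)
    moreover have "4 * rinner (T x) y = rinner (T (x + y)) (x + y) - rinner (T (x - y)) (x - y)"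
      by (simp add: rinner_quadratic_add[OF T] rinner_quadratic_diff[OF T])
    moreover have "\<dots> \<le> c * (norm (x + y))\<^sup>2 + c * (norm (x - y))\<^sup>2"
      using le[of "x + y"] le[of "x - y"] by simp
    moreover have "\<dots> = c * (4 * (norm x)\<^sup>2)"
      using parallelogram[of x y] ny by (simp flip: distrib_left)
    ultimately have "4 * (norm x * norm (T x)) \<le> 4 * (norm x * (c * norm x))"
      by (simp only: power2_eq_square) (simp add: mult.left_commute)
    then have "norm x * norm (T x) \<le> norm x * (c * norm x)" by simp
    moreover have "x \<noteq> 0" using False by (metis blinfun.zero_right)
    ultimately show ?thesis by simp
  qed (simp add: c)
qed

lemma abs_rinner_le:
  fixes T :: "'a::complex_inner_space endo"
  shows "\<bar>rinner (T x) x\<bar> \<le> norm T * (norm x)\<^sup>2"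
proof -
  have "\<bar>rinner (T x) x\<bar> \<le> norm (T x) * norm x" by (rule abs_rinner_le_norm)
  also have "\<dots> \<le> (norm T * norm x) * norm x" by (intro mult_right_mono norm_blinfun norm_ge_zero)
  finally show ?thesis by (simp add: power2_eq_square)
qed

text \<open>The Cauchy-Schwarz argument for a positive form \<open>q\<close>: if \<open>q\<close> vanishes at \<open>x\<close>, then
  \<open>q (x - t *\<^sub>R R x) \<ge> 0\<close> for small \<open>t > 0\<close> forces \<open>R x = 0\<close>.\<close>

lemma positive_form_zero:
  fixes R :: "'a::complex_inner_space endo"
  assumes R: "symmetric R" "\<And>y. 0 \<le> rinner (R y) y" and x: "rinner (R x) x = 0"
  shows "R x = 0"
proof (rule ccontr)
  assume ne: "R x \<noteq> 0"
  define k where "k = rinner (R (R x)) (R x)"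
  define n where "n = (norm (R x))\<^sup>2"
  have n: "n > 0" using ne by (simp add: n_def)
  have k: "k \<ge> 0" using R(2) by (simp add: k_def)
  define t where "t = n / (k + 1)"
  have "0 \<le> rinner (R (x - t *\<^sub>R R x)) (x - t *\<^sub>R R x)" by (rule R(2))
  also have "\<dots> = - 2 * t * n + t\<^sup>2 * k"
    by (simp add: rinner_quadratic_diff[OF R(1)] x rinner.scaleR_right rinner_self n_def
        blinfun.scaleR_right rinner.scaleR_left k_def power2_eq_square)
  also have "t\<^sup>2 * k \<le> t * n"
  proof -
    have "t * k \<le> n" using n k by (simp add: t_def field_simps)
    moreover have "0 \<le> t" using n k by (simp add: t_def)
    ultimately show ?thesis by (metis mult.assoc mult_left_mono power2_eq_square)
  qed
  finally have "t * n \<le> 0" by (simp add: mult.commute)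
  moreover have "0 < t" using n k by (simp add: t_def)
  ultimately show False using n by (simp add: mult_le_0_iff)
qed


section \<open>The absolute value of a symmetric operator\<close>

interpretation blinfun_compose: bounded_bilinear "(o\<^sub>L)"
  by (rule bounded_bilinear_blinfun_compose)

lemma blinfun_compose_assoc: "(S o\<^sub>L T) o\<^sub>L U = S o\<^sub>L (T o\<^sub>L U)"
  by (rule blinfun_eqI) simp

lemma id_blinfun_compose: "id_blinfun o\<^sub>L T = T" "T o\<^sub>L id_blinfun = T"
  by (simp_all add: blinfun_eqI)

lemma symmetric_tendsto:
  assumes lim: "Y \<longlonglongrightarrow> L" and Y: "\<And>n. symmetric (Y n)"
  shows "symmetric L"
  unfolding symmetric_def
proof (intro allI)
  fix x y
  have "(\<lambda>n. rinner (Y n x) y) \<longlonglongrightarrow> rinner (L x) y"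
    and "(\<lambda>n. rinner x (Y n y)) \<longlonglongrightarrow> rinner x (L y)"
    by (intro rinner.tendsto blinfun.tendsto lim tendsto_const)+
  then show "rinner (L x) y = rinner x (L y)"
    using symmetricD[OF Y] LIMSEQ_unique by auto
qed

text \<open>With \<open>C = 1 - X\<^sup>2\<close>, the square root of \<open>X\<^sup>2\<close> is \<open>1 - L\<close> for a solution of
  \<open>L = (C + L\<^sup>2) / 2\<close>.  Iterating this equation from \<open>0\<close> converges in norm because the same
  iteration for the number \<open>1\<close> in place of \<open>C\<close> is an increasing sequence bounded by \<open>1\<close>,
  which dominates the differences of consecutive operators.\<close>

lemma ex_abs_contraction:
  fixes X :: "'a::complex_hilbert_space endo"
  assumes X: "symmetric X" and X1: "norm X \<le> 1"
  shows "\<exists>R. symmetric R \<and> (\<forall>x. 0 \<le> rinner (R x) x) \<and> R o\<^sub>L R = X o\<^sub>L X \<and>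
    (\<forall>D. D o\<^sub>L X = X o\<^sub>L D \<longrightarrow> D o\<^sub>L R = R o\<^sub>L D)"
proof -
  define C where "C = id_blinfun - (X o\<^sub>L X)"
  have symC: "symmetric C"
    unfolding C_def using X by (intro symmetric_diff) (auto simp: symmetric_def)
  have C1: "norm C \<le> 1"
  proof (rule symmetric_norm_le[OF symC])
    fix x
    have "(norm (X x))\<^sup>2 \<le> (norm X * norm x)\<^sup>2" by (intro power_mono norm_blinfun norm_ge_zero)
    also have "\<dots> \<le> (1 * norm x)\<^sup>2" using X1 by (intro power_mono mult_right_mono) auto
    finally have "(norm (X x))\<^sup>2 \<le> (norm x)\<^sup>2" by simp
    moreover have "rinner (C x) x = (norm x)\<^sup>2 - (norm (X x))\<^sup>2"
      using symmetricD[OF X, of "X x" x]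
      by (simp add: C_def blinfun.diff_left rinner.diff_left rinner_self)
    ultimately show "\<bar>rinner (C x) x\<bar> \<le> 1 * (norm x)\<^sup>2" by simp
  qed simp
  define Y where "Y = rec_nat (0::'a endo) (\<lambda>_ V. (1/2) *\<^sub>R (C + (V o\<^sub>L V)))"
  define y where "y = rec_nat (0::real) (\<lambda>_ v. (1 + v * v) / 2)"
  have Y0: "Y 0 = 0" and YS: "Y (Suc n) = (1/2) *\<^sub>R (C + (Y n o\<^sub>L Y n))" for n
    by (simp_all add: Y_def)
  have y0: "y 0 = 0" and yS: "y (Suc n) = (1 + y n * y n) / 2" for n
    by (simp_all add: y_def)
  have y_bounds: "0 \<le> y n \<and> y n \<le> 1" for n
  proof (induction n)
    case (Suc n)
    then have "y n * y n \<le> 1" by (simp add: mult_le_one)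
    then show ?case by (simp add: yS)
  qed (simp add: y0)
  have y_mono: "y n \<le> y (Suc n)" for n
    using zero_le_square[of "1 - y n"] by (simp add: yS algebra_simps)
  have Y_le: "norm (Y n) \<le> y n" for n
  proof (induction n)
    case (Suc n)
    have "norm (C + (Y n o\<^sub>L Y n)) \<le> norm C + norm (Y n) * norm (Y n)"
      by (rule order_trans[OF norm_triangle_ineq add_left_mono[OF norm_blinfun_compose]])
    also have "\<dots> \<le> 1 + y n * y n" using C1 Suc by (intro add_mono mult_mono) (auto simp: y_bounds)
    finally show ?case by (simp add: YS yS)
  qed (simp add: Y0 y0)
  have symY: "symmetric (Y n)" for n
  proof (induction n)
    case (Suc n)
    then have "symmetric (Y n o\<^sub>L Y n)" by (simp add: symmetric_def)
    then show ?case by (simp add: YS symmetric_scaleR symmetric_add symC)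
  qed (simp add: Y0)
  have Y_comm: "D o\<^sub>L Y n = Y n o\<^sub>L D" if D: "D o\<^sub>L X = X o\<^sub>L D" for D n
  proof (induction n)
    case (Suc n)
    have "D o\<^sub>L (X o\<^sub>L X) = (X o\<^sub>L X) o\<^sub>L D" by (metis D blinfun_compose_assoc)
    moreover have "D o\<^sub>L (Y n o\<^sub>L Y n) = (Y n o\<^sub>L Y n) o\<^sub>L D" by (metis Suc blinfun_compose_assoc)
    ultimately show ?case
      by (simp add: YS C_def blinfun_compose.add_left blinfun_compose.add_right
          blinfun_compose.diff_left blinfun_compose.diff_right
          blinfun_compose.scaleR_left blinfun_compose.scaleR_right id_blinfun_compose)
  qed (simp add: Y0 blinfun_compose.zero_left blinfun_compose.zero_right)
  have YY: "Y m o\<^sub>L Y n = Y n o\<^sub>L Y m" for m n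
    using Y_comm[OF Y_comm[OF refl, symmetric]] .
  have Y_step: "norm (Y (Suc n) - Y n) \<le> y (Suc n) - y n" for n
  proof (induction n)
    case 0
    show ?case using Y_le[of "Suc 0"] by (simp add: Y0 y0)
  next
    case (Suc n)
    have "(Y (Suc n) - Y n) o\<^sub>L (Y (Suc n) + Y n) = (Y (Suc n) o\<^sub>L Y (Suc n)) - (Y n o\<^sub>L Y n)"
      by (simp add: blinfun_compose.diff_left blinfun_compose.add_right YY[of n "Suc n"])
    also have "\<dots> = 2 *\<^sub>R (Y (Suc (Suc n)) - Y (Suc n))"
      by (simp only: YS[of "Suc n"] YS[of n, symmetric] scaleR_diff_right)
        (simp add: YS[of n] algebra_simps)
    finally have "2 * norm (Y (Suc (Suc n)) - Y (Suc n)) =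
        norm ((Y (Suc n) - Y n) o\<^sub>L (Y (Suc n) + Y n))" by simp
    also have "\<dots> \<le> norm (Y (Suc n) - Y n) * norm (Y (Suc n) + Y n)"
      by (rule norm_blinfun_compose)
    also have "\<dots> \<le> (y (Suc n) - y n) * (y (Suc n) + y n)"
      using Suc Y_le[of n] Y_le[of "Suc n"] y_mono[of n] norm_triangle_ineq[of "Y (Suc n)" "Y n"]
      by (intro mult_mono) auto
    also have "\<dots> = 2 * (y (Suc (Suc n)) - y (Suc n))"
      by (simp add: yS algebra_simps)
    finally show ?case by simp
  qed
  obtain l where "y \<longlonglongrightarrow> l"
    using incseq_convergent[of y 1] y_mono y_bounds by (meson incseq_SucI)
  then have "summable (\<lambda>n. y (Suc n) - y n)" by (rule telescope_summable)
  then have "summable (\<lambda>n. Y (Suc n) - Y n)"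
    by (rule summable_comparison_test') (rule Y_step)
  then obtain L where "(\<lambda>n. \<Sum>k<n. Y (Suc k) - Y k) \<longlonglongrightarrow> L"
    by (auto simp: summable_def sums_def)
  then have L: "Y \<longlonglongrightarrow> L" by (simp add: sum_lessThan_telescope Y0)
  have "(\<lambda>n. Y (Suc n)) \<longlonglongrightarrow> (1/2) *\<^sub>R (C + (L o\<^sub>L L))"
    unfolding YS by (intro tendsto_intros blinfun_compose.tendsto L)
  then have L_eq: "L = (1/2) *\<^sub>R (C + (L o\<^sub>L L))"
    using L LIMSEQ_Suc LIMSEQ_unique by blast
  have L_norm: "norm L \<le> 1"
    using Y_le y_bounds by (intro LIMSEQ_le_const2[OF tendsto_norm[OF L]]) (meson order_trans)
  have symL: "symmetric L" by (rule symmetric_tendsto[OF L symY])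
  define R where "R = id_blinfun - L"
  have "symmetric R" by (simp add: R_def symmetric_diff symL)
  moreover have "0 \<le> rinner (R x) x" for x
  proof -
    have "rinner (L x) x \<le> norm L * (norm x)\<^sup>2" using abs_rinner_le[of L x] by simp
    also have "\<dots> \<le> 1 * (norm x)\<^sup>2" using L_norm by (intro mult_right_mono) auto
    finally show ?thesis by (simp add: R_def blinfun.diff_left rinner.diff_left rinner_self)
  qed
  moreover have "R o\<^sub>L R = X o\<^sub>L X"
  proof -
    have "2 *\<^sub>R L = C + (L o\<^sub>L L)" by (subst L_eq) simp
    then have "id_blinfun - L - L + (L o\<^sub>L L) = X o\<^sub>L X"
      by (simp add: C_def scaleR_2 algebra_simps)
    moreover have "R o\<^sub>L R = id_blinfun - L - L + (L o\<^sub>L L)"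
      by (rule blinfun_eqI) (simp add: R_def blinfun.diff_left blinfun.add_left blinfun.diff_right)
    ultimately show ?thesis by simp
  qed
  moreover have "D o\<^sub>L R = R o\<^sub>L D" if D: "D o\<^sub>L X = X o\<^sub>L D" for D
  proof -
    have "(\<lambda>n. D o\<^sub>L Y n) \<longlonglongrightarrow> (D o\<^sub>L L)" "(\<lambda>n. Y n o\<^sub>L D) \<longlonglongrightarrow> (L o\<^sub>L D)"
      by (intro blinfun_compose.tendsto L tendsto_const)+
    then have "D o\<^sub>L L = L o\<^sub>L D" using Y_comm[OF D] LIMSEQ_unique by auto
    then show ?thesis
      by (simp add: R_def blinfun_compose.diff_left blinfun_compose.diff_right id_blinfun_compose)
  qed
  ultimately show ?thesis by blast
qed


section \<open>Splitting a symmetric operator into its negative and positive part\<close>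

definition proj_op :: "'a::complex_inner_space endo \<Rightarrow> bool" where
  "proj_op P \<longleftrightarrow> symmetric P \<and> (\<forall>x. P (P x) = P x)"

lemma proj_op_symmetric: "proj_op P \<Longrightarrow> symmetric P"
  and proj_op_idem: "proj_op P \<Longrightarrow> P (P x) = P x"
  by (simp_all add: proj_op_def)

lemma orth_projection_iff: "orth_projection P \<longleftrightarrow> bounded_op P \<and> proj_op P"
proof -
  have "P o\<^sub>L P = P \<longleftrightarrow> (\<forall>x. P (P x) = P x)"
    by (metis blinfun_apply_blinfun_compose blinfun_eqI)
  then show ?thesis by (auto simp: orth_projection_def self_adjoint_iff proj_op_def)
qed

lemma proj_op_quadratic: "proj_op P \<Longrightarrow> rinner (P x) x = (norm (P x))\<^sup>2"
  by (metis proj_op_def rinner_self symmetricD)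

lemma proj_op_pythagoras:
  assumes "proj_op P"
  shows "(norm x)\<^sup>2 = (norm (P x))\<^sup>2 + (norm (x - P x))\<^sup>2"
  using norm_minus_sqr[of x "P x"] proj_op_quadratic[OF assms, of x] by (simp add: rinner_commute)

lemma proj_op_complement: "proj_op P \<Longrightarrow> proj_op (id_blinfun - P)"
  by (auto simp: proj_op_def blinfun.diff_left blinfun.diff_right symmetric_diff)

lemma proj_op_of_subspace:
  fixes K :: "'a::complex_hilbert_space set"
  assumes K: "subspace K" "closed K"
  obtains P :: "'a endo" where "proj_op P" "\<And>x. P x = x \<longleftrightarrow> x \<in> K"
    "\<And>x. P x = 0 \<longleftrightarrow> (\<forall>k\<in>K. rinner x k = 0)"
proof -
  obtain P :: "'a endo" where PK: "\<And>x. P x \<in> K" and orth: "\<And>x k. k \<in> K \<Longrightarrow> rinner (x - P x) k = 0"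
    using ex_projection[OF K] by metis
  have fix_K: "P x = x" if "x \<in> K" for x
  proof -
    have "x - P x \<in> K" using that PK K by (simp add: subspace_diff)
    then have "rinner (x - P x) (x - P x) = 0" by (rule orth)
    then show ?thesis by (simp add: rinner_self)
  qed
  have "rinner (P x) y = rinner (P x) (P y)" for x y
    using orth[OF PK[of x], of y]
    by (simp add: rinner.diff_left rinner_commute[of "P x"])
  then have "proj_op P" unfolding proj_op_def symmetric_def
    using fix_K[OF PK] by (metis rinner_commute)
  moreover have "P x = x \<longleftrightarrow> x \<in> K" for x using fix_K PK by metis
  moreover have "P x = 0 \<longleftrightarrow> (\<forall>k\<in>K. rinner x k = 0)" for x
  proof
    show "P x = 0 \<Longrightarrow> \<forall>k\<in>K. rinner x k = 0" using orth[of _ x] by auto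
    assume "\<forall>k\<in>K. rinner x k = 0"
    then have "rinner x (P x) = 0" using PK by blast
    then have "rinner (P x) (P x) = 0" using orth[OF PK[of x], of x] by (simp add: rinner.diff_left)
    then show "P x = 0" by (simp add: rinner_self)
  qed
  ultimately show ?thesis using that by blast
qed

text \<open>An operator commutes with the projection onto a subspace that is invariant under the operator
  and its adjoint, since then it preserves the orthogonal complement too; hence the adjoint
  \<open>D'\<close> has to commute with \<open>X\<close> as well.\<close>

definition commutes_star :: "'a::complex_inner_space endo \<Rightarrow> 'a endo \<Rightarrow> bool" where
  "commutes_star X D \<longleftrightarrow> (\<forall>x. D (X x) = X (D x)) \<and>
     (\<exists>D' :: 'a endo. (\<forall>x. D' (X x) = X (D' x)) \<and> (\<forall>x y. rinner (D x) y = rinner x (D' y)))"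

lemma commutes_star_symmetric:
  fixes D X :: "'a::complex_inner_space endo"
  shows "symmetric D \<Longrightarrow> (\<And>x. D (X x) = X (D x)) \<Longrightarrow> commutes_star X D"
  unfolding commutes_star_def symmetric_def by blast

lemma commutes_star_scaleC:
  fixes X :: "'a::complex_hilbert_space endo"
  assumes "bounded_op X"
  shows "commutes_star X (Blinfun ((*\<^sub>C) c))"
  unfolding commutes_star_def
  by (intro conjI exI[of _ "Blinfun ((*\<^sub>C) (cnj c))"])
    (simp_all add: bounded_linear_Blinfun_apply bounded_linear_scaleC rinner_scaleC_left
      bounded_op_scaleC[OF assms])

lemma bounded_op_if_commutes:
  fixes X P :: "'a::complex_hilbert_space endo"
  assumes X: "bounded_op X" and P: "\<And>D x. commutes_star X D \<Longrightarrow> D (P x) = P (D x)"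
  shows "bounded_op P"
  using P[OF commutes_star_scaleC[OF X]]
  by (simp add: bounded_op_def bounded_linear_Blinfun_apply bounded_linear_scaleC)

text \<open>The spectral projection of \<open>X\<close> for the half-line up to \<open>0\<close> projects onto the kernel of
  \<open>R + X\<close>, where \<open>R = \<bar>X\<bar>\<close>: there \<open>X = - R \<le> 0\<close>, and since \<open>(R + X) (R - X) = 0\<close>, the
  operator \<open>X\<close> equals \<open>R \<ge> 0\<close> on the orthogonal complement.\<close>

lemma ex_splitting:
  fixes X :: "'a::complex_hilbert_space endo"
  assumes X: "symmetric X"
  obtains P where "proj_op P" "\<And>D x. commutes_star X D \<Longrightarrow> D (P x) = P (D x)"
    "\<And>x. P x = x \<Longrightarrow> rinner (X x) x \<le> 0"
    "\<And>x. P x = 0 \<Longrightarrow> 0 \<le> rinner (X x) x"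
    "\<And>x. P x = 0 \<Longrightarrow> rinner (X x) x = 0 \<Longrightarrow> x = 0"
proof -
  define s where "s = 1 / (1 + norm X)"
  have s: "s > 0" unfolding s_def by (simp add: add_pos_nonneg)
  define U where "U = s *\<^sub>R X"
  have U: "symmetric U" by (simp add: U_def symmetric_scaleR X)
  have "norm U \<le> 1" by (simp add: U_def s_def divide_le_eq_1 add_pos_nonneg)
  then obtain R where R: "symmetric R" "\<And>x. 0 \<le> rinner (R x) x" and RR: "R o\<^sub>L R = U o\<^sub>L U"
    and R_comm: "\<And>D. D o\<^sub>L U = U o\<^sub>L D \<Longrightarrow> D o\<^sub>L R = R o\<^sub>L D"
    using ex_abs_contraction[OF U] by blast
  have RR': "R (R x) = U (U x)" for x by (metis RR blinfun_apply_blinfun_compose)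
  have UR: "U (R x) = R (U x)" for x by (metis R_comm blinfun_apply_blinfun_compose)
  have D_U: "(\<forall>x. D (X x) = X (D x)) \<Longrightarrow> D (U x) = U (D x)" for x and D :: "'a endo"
    by (simp add: U_def blinfun.scaleR_left blinfun.scaleR_right)
  have D_R: "D (R x) = R (D x)" if "\<forall>x. D (X x) = X (D x)" for x and D :: "'a endo"
  proof -
    have "D o\<^sub>L U = U o\<^sub>L D" by (rule blinfun_eqI) (simp add: D_U that)
    then show ?thesis using R_comm by (metis blinfun_apply_blinfun_compose)
  qed
  define K where "K = {x. (R + U) x = 0}"
  have "subspace K"
    by (auto simp: K_def subspace_def blinfun.add_right blinfun.scaleR_right)
  moreover have "closed K"
    unfolding K_def by (intro closed_Collect_eq continuous_intros)
  ultimately obtain P :: "'a endo" where P: "proj_op P" and P1: "\<And>x. P x = x \<longleftrightarrow> x \<in> K"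
    and P0: "\<And>x. P x = 0 \<longleftrightarrow> (\<forall>k\<in>K. rinner x k = 0)"
    using proj_op_of_subspace by blast
  have on_K: "U x = - R x" if "P x = x" for x
    using that P1[of x] by (simp add: K_def blinfun.add_left eq_neg_iff_add_eq_0 add.commute)
  have on_perp: "U x = R x" if "P x = 0" for x
  proof -
    have "R x - U x \<in> K"
      by (simp add: K_def blinfun.add_left blinfun.diff_right RR' UR)
    then have "R (R x - U x) + U (R x - U x) = 0" "rinner x (R x - U x) = 0"
      using that P0[of x] by (auto simp: K_def blinfun.add_left)
    then have flip: "R (R x - U x) = - U (R x - U x)" by (simp add: eq_neg_iff_add_eq_0)
    have "rinner (R x - U x) (R x - U x) = rinner x (R (R x - U x) - U (R x - U x))"
      using symmetricD[OF R(1)] symmetricD[OF U]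
      by (simp add: rinner.diff_left rinner.diff_right blinfun.diff_right)
    also have "R (R x - U x) - U (R x - U x) = 2 *\<^sub>R R (R x - U x)"
      using flip by (simp add: scaleR_2)
    also have "R (R x - U x) \<in> K"
    proof -
      have "(R + U) (R (R x - U x)) = R ((R + U) (R x - U x))"
        by (simp add: blinfun.add_left blinfun.add_right UR)
      then show ?thesis using \<open>R x - U x \<in> K\<close> by (simp add: K_def)
    qed
    then have "rinner x (2 *\<^sub>R R (R x - U x)) = 0"
      using that P0 by (simp add: rinner.scaleR_right)
    finally show ?thesis by (simp add: rinner_self)
  qed
  have UX: "rinner (U x) x = s * rinner (X x) x" for x
    by (simp add: U_def blinfun.scaleR_left rinner.scaleR_left)
  show ?thesis
  proof
    show "proj_op P" by fact
  next
    fix D x assume "commutes_star X D"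
    then obtain D' :: "'a endo" where D: "\<forall>x. D (X x) = X (D x)" and D': "\<forall>x. D' (X x) = X (D' x)"
      and adj: "\<And>x y. rinner (D x) y = rinner x (D' y)"
      unfolding commutes_star_def by blast
    have inv: "D x \<in> K" "D' x \<in> K" if "x \<in> K" for x
    proof -
      have "(R + U) (D x) = D ((R + U) x)" "(R + U) (D' x) = D' ((R + U) x)"
        by (simp_all add: blinfun.add_left blinfun.add_right D_R[OF D] D_R[OF D'] D_U[OF D] D_U[OF D'])
      then show "D x \<in> K" "D' x \<in> K" using that by (simp_all add: K_def)
    qed
    have "P (D (P x)) = D (P x)" using inv P1 proj_op_idem[OF P] by blast
    moreover have "P (x - P x) = 0" by (simp add: blinfun.diff_right proj_op_idem[OF P])
    then have "P (D (x - P x)) = 0" unfolding P0 adj using inv by blast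
    ultimately show "D (P x) = P (D x)" by (simp add: blinfun.diff_right)
  next
    fix x assume "P x = x"
    then have "s * rinner (X x) x \<le> 0"
      using R(2)[of x] on_K[of x] by (simp add: UX[symmetric] rinner.minus_left)
    then show "rinner (X x) x \<le> 0" using s by (simp add: mult_le_0_iff)
  next
    fix x assume "P x = 0"
    then have "0 \<le> s * rinner (X x) x"
      using R(2)[of x] on_perp[of x] by (simp add: UX[symmetric])
    then show "0 \<le> rinner (X x) x" using s by (simp add: zero_le_mult_iff)
  next
    fix x assume Px: "P x = 0" and "rinner (X x) x = 0"
    then have "rinner (R x) x = 0" using on_perp[of x] UX[of x] by simp
    then have "R x = 0" by (rule positive_form_zero[OF R])
    then have "(R + U) x = 0" using on_perp[OF Px] by (simp add: blinfun.add_left)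
    then have "x \<in> K" by (simp add: K_def)
    then show "x = 0" using P1 Px by metis
  qed
qed


section \<open>Series of orthogonal projections\<close>

lemma proj_op_norm_le: "proj_op P \<Longrightarrow> norm (P x) \<le> norm x"
  using proj_op_pythagoras[of P x] by (intro power2_le_imp_le[OF _ norm_ge_zero]) simp

lemma proj_op_series:
  fixes Q :: "nat \<Rightarrow> 'a::complex_hilbert_space endo"
  assumes Q: "\<And>n. proj_op (Q n)" and orth: "\<And>m n x. m \<noteq> n \<Longrightarrow> Q m (Q n x) = 0"
  obtains P where "proj_op P" "\<And>x. (\<lambda>n. Q n x) sums P x"
proof -
  have orth': "rinner (Q m x) (Q n y) = 0" if "m \<noteq> n" for m n x y
    using symmetricD[OF proj_op_symmetric[OF Q], of m x "Q n y"] orth[OF that]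
    by (simp add: rinner.zero_right)
  have norm_sum_sqr: "(norm (\<Sum>k\<in>I. Q k x))\<^sup>2 = (\<Sum>k\<in>I. (norm (Q k x))\<^sup>2)" if "finite I" for I x
    using that
  proof (induction I)
    case (insert i I)
    have "rinner (Q i x) (\<Sum>k\<in>I. Q k x) = (\<Sum>k\<in>I. 0)"
      unfolding rinner.sum_right using insert.hyps by (intro sum.cong) (auto intro: orth')
    then show ?case using insert by (simp add: norm_plus_sqr)
  qed simp
  have norm_sum_le: "norm (\<Sum>k\<in>I. Q k x) \<le> norm x" if "finite I" for I x
  proof -
    have "(norm (\<Sum>k\<in>I. Q k x))\<^sup>2 = (\<Sum>k\<in>I. rinner (Q k x) x)"
      by (simp add: norm_sum_sqr[OF that] proj_op_quadratic[OF Q])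
    also have "\<dots> = rinner (\<Sum>k\<in>I. Q k x) x" by (simp add: rinner.sum_left)
    also have "\<dots> \<le> norm (\<Sum>k\<in>I. Q k x) * norm x" by (rule rinner_le_norm)
    finally have "norm (\<Sum>k\<in>I. Q k x) * norm (\<Sum>k\<in>I. Q k x) \<le> norm (\<Sum>k\<in>I. Q k x) * norm x"
      by (simp add: power2_eq_square)
    then show ?thesis
      by (cases "norm (\<Sum>k\<in>I. Q k x) = 0") (auto simp: mult_le_cancel_left)
  qed
  have "summable (\<lambda>n. (norm (Q n x))\<^sup>2)" for x
  proof (rule bounded_imp_summable)
    show "(\<Sum>k\<le>n. (norm (Q k x))\<^sup>2) \<le> (norm x)\<^sup>2" for n
      using norm_sum_le[of "{..n}" x] by (simp flip: norm_sum_sqr add: power_mono)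
  qed simp
  then have sqr_Cauchy: "\<exists>N. \<forall>m\<ge>N. \<forall>n. norm (\<Sum>k=m..<n. (norm (Q k x))\<^sup>2) < e" if "e > 0" for e x
    using that by (simp add: summable_Cauchy)
  have summable: "summable (\<lambda>n. Q n x)" for x
    unfolding summable_Cauchy
  proof (intro allI impI)
    fix e :: real assume e: "0 < e"
    then obtain N where N: "\<forall>m\<ge>N. \<forall>n. norm (\<Sum>k=m..<n. (norm (Q k x))\<^sup>2) < e\<^sup>2"
      using sqr_Cauchy[of "e\<^sup>2" x] by auto
    have "norm (\<Sum>k=m..<n. Q k x) < e" if "m \<ge> N" for m n
    proof -
      have "(norm (\<Sum>k=m..<n. Q k x))\<^sup>2 < e\<^sup>2"
        using N that by (simp add: norm_sum_sqr sum_nonneg)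
      then show ?thesis using e by (simp add: power_less_imp_less_base)
    qed
    then show "\<exists>N. \<forall>m\<ge>N. \<forall>n. norm (\<Sum>k=m..<n. Q k x) < e" by blast
  qed
  define p where "p x = (\<Sum>n. Q n x)" for x
  have p: "(\<lambda>n. Q n x) sums p x" for x
    using summable by (simp add: p_def summable_sums)
  have "bounded_linear p"
  proof (rule bounded_linear_intro[where K = 1])
    show "p (x + y) = p x + p y" for x y
      using sums_unique2[OF p[of "x + y"]] sums_add[OF p p, of x y] by (simp add: blinfun.add_right)
    show "p (r *\<^sub>R x) = r *\<^sub>R p x" for r x
      using sums_unique2[OF p[of "r *\<^sub>R x"]] sums_scaleR_right[OF p, of r x]
      by (simp add: blinfun.scaleR_right)
    have "(\<lambda>n. norm (\<Sum>k<n. Q k x)) \<longlonglongrightarrow> norm (p x)" for x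
      using p[of x] by (intro tendsto_norm) (simp add: sums_def)
    then have "norm (p x) \<le> norm x" for x
      by (rule LIMSEQ_le_const2) (use norm_sum_le in blast)
    then show "norm (p x) \<le> norm x * 1" for x by simp
  qed
  define P where "P = Blinfun p"
  have P: "(\<lambda>n. Q n x) sums P x" for x
    unfolding P_def using \<open>bounded_linear p\<close> p by (simp add: bounded_linear_Blinfun_apply)
  have "symmetric P"
    unfolding symmetric_def
  proof (intro allI)
    fix x y
    have "(\<lambda>n. rinner (Q n x) y) sums rinner (P x) y"
      by (rule bounded_linear.sums[OF rinner.bounded_linear_left P])
    moreover have "(\<lambda>n. rinner x (Q n y)) sums rinner x (P y)"
      by (rule bounded_linear.sums[OF rinner.bounded_linear_right P])
    ultimately show "rinner (P x) y = rinner x (P y)"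
      using symmetricD[OF proj_op_symmetric[OF Q]] sums_unique2 by auto
  qed
  moreover have "P (P x) = P x" for x
  proof -
    have "Q m (P x) = Q m x" for m
    proof -
      have "(\<lambda>n. Q m (Q n x)) sums Q m (P x)"
        by (rule bounded_linear.sums[OF blinfun.bounded_linear_right P])
      moreover have "(\<lambda>n. Q m (Q n x)) = (\<lambda>n. if n = m then Q m x else 0)"
        using orth proj_op_idem[OF Q] by fastforce
      ultimately show ?thesis using sums_single[of m "\<lambda>_. Q m x"] sums_unique2 by auto
    qed
    then show ?thesis using P[of "P x"] P[of x] sums_unique2 by auto
  qed
  ultimately have "proj_op P" by (simp add: proj_op_def)
  then show ?thesis using that P by blast
qed


section \<open>The spectral family of a symmetric operator\<close>

text \<open>\<open>E a\<close> plays the role of the spectral projection of \<open>T\<close> for the half-line up to \<open>a\<close>; the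
  last assumption puts the eigenvectors for \<open>a\<close> itself into its range, which makes the family
  right-continuous, as distribution functions are.\<close>

locale spectral_family =
  fixes T :: "'a::complex_hilbert_space endo" and E :: "real \<Rightarrow> 'a endo"
  assumes symmetric_T: "symmetric T" and bounded_op_T: "bounded_op T"
    and proj_E: "\<And>a. proj_op (E a)"
    and commutes_E: "\<And>D a x. commutes_star T D \<Longrightarrow> D (E a x) = E a (D x)"
    and E_upper: "\<And>a x. E a x = x \<Longrightarrow> rinner (T x) x \<le> a * (norm x)\<^sup>2"
    and E_lower: "\<And>a x. E a x = 0 \<Longrightarrow> a * (norm x)\<^sup>2 \<le> rinner (T x) x"
    and E_strict: "\<And>a x. E a x = 0 \<Longrightarrow> rinner (T x) x = a * (norm x)\<^sup>2 \<Longrightarrow> x = 0"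

lemma ex_spectral_family:
  fixes T :: "'a::complex_hilbert_space endo"
  assumes T: "symmetric T" "bounded_op T"
  shows "\<exists>E. spectral_family T E"
proof -
  let ?X = "\<lambda>a. T - a *\<^sub>R id_blinfun"
  have X: "symmetric (?X a)" for a
    by (intro symmetric_diff symmetric_scaleR T symmetric_id)
  have quad: "rinner (?X a x) x = rinner (T x) x - a * (norm x)\<^sup>2" for a x
    by (simp add: blinfun.diff_left blinfun.scaleR_left rinner.diff_left rinner.scaleR_left rinner_self)
  have comm: "commutes_star (?X a) D" if "commutes_star T D" for a D
    using that unfolding commutes_star_def
    by (simp add: blinfun.diff_left blinfun.scaleR_left blinfun.diff_right blinfun.scaleR_right)
  have "\<exists>P. proj_op P \<and> (\<forall>D x. commutes_star T D \<longrightarrow> D (P x) = P (D x)) \<and>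
      (\<forall>x. P x = x \<longrightarrow> rinner (T x) x \<le> a * (norm x)\<^sup>2) \<and>
      (\<forall>x. P x = 0 \<longrightarrow> a * (norm x)\<^sup>2 \<le> rinner (T x) x) \<and>
      (\<forall>x. P x = 0 \<longrightarrow> rinner (T x) x = a * (norm x)\<^sup>2 \<longrightarrow> x = 0)" for a
    using ex_splitting[OF X[of a], unfolded quad] comm
    by (smt (verit, best))
  then obtain E where "\<forall>a. proj_op (E a) \<and> (\<forall>D x. commutes_star T D \<longrightarrow> D (E a x) = E a (D x)) \<and>
      (\<forall>x. E a x = x \<longrightarrow> rinner (T x) x \<le> a * (norm x)\<^sup>2) \<and>
      (\<forall>x. E a x = 0 \<longrightarrow> a * (norm x)\<^sup>2 \<le> rinner (T x) x) \<and>
      (\<forall>x. E a x = 0 \<longrightarrow> rinner (T x) x = a * (norm x)\<^sup>2 \<longrightarrow> x = 0)"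
    by metis
  then show ?thesis using T by (intro exI[of _ E] spectral_family.intro) blast+
qed

context spectral_family
begin

lemma E_idem: "E a (E a x) = E a x"
  by (rule proj_op_idem[OF proj_E])

lemma bounded_op_E: "bounded_op (E a)"
  by (rule bounded_op_if_commutes[OF bounded_op_T commutes_E])

lemma T_E: "T (E a x) = E a (T x)"
  by (rule commutes_E[OF commutes_star_symmetric[OF symmetric_T refl]])

lemma E_commute: "E b (E a x) = E a (E b x)"
  by (rule commutes_E[OF commutes_star_symmetric[OF proj_op_symmetric[OF proj_E] T_E[symmetric]]])

lemma E_absorb:
  assumes "a \<le> b"
  shows "E b (E a x) = E a x"
proof (cases "a = b")
  case False
  define z where "z = E a x - E b (E a x)"
  have "E b z = 0" by (simp add: z_def blinfun.diff_right E_idem)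
  then have "b * (norm z)\<^sup>2 \<le> rinner (T z) z" by (rule E_lower)
  moreover have "E a z = z" by (simp add: z_def blinfun.diff_right E_idem E_commute[of a b])
  then have "rinner (T z) z \<le> a * (norm z)\<^sup>2" by (rule E_upper)
  ultimately have "(b - a) * (norm z)\<^sup>2 \<le> 0" by (simp add: algebra_simps)
  then have "z = 0" using assms False by (simp add: mult_le_0_iff)
  then show ?thesis by (simp add: z_def)
qed (simp add: E_idem)

lemma norm_E_diff:
  assumes "a \<le> b"
  shows "(norm (E b x - E a x))\<^sup>2 = (norm (E b x))\<^sup>2 - (norm (E a x))\<^sup>2"
  using proj_op_pythagoras[OF proj_E[of a], of "E b x"] E_absorb[OF assms, of x]
  by (simp add: E_commute[of a b])

lemma norm_E_mono: "a \<le> b \<Longrightarrow> (norm (E a x))\<^sup>2 \<le> (norm (E b x))\<^sup>2"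
  by (metis norm_E_diff diff_ge_0_iff_ge zero_le_power2)

text \<open>The limit \<open>v\<close> of \<open>E b x\<close> as \<open>b\<close> decreases to \<open>a\<close> lies in the range of each \<open>E c\<close> with
  \<open>c > a\<close>, so \<open>T = a\<close> on its part orthogonal to the range of \<open>E a\<close>, which therefore vanishes.\<close>

lemma E_right_continuous: "(\<lambda>n. E (a + inverse (real (Suc n))) x) \<longlonglongrightarrow> E a x"
proof -
  define b where "b n = a + inverse (real (Suc n))" for n
  define F where "F n = (norm (E (b n) x))\<^sup>2" for n
  have b_dec: "b n \<le> b m" if "m \<le> n" for m n
    using that by (simp add: b_def le_imp_inverse_le)
  have "decseq F" unfolding decseq_def F_def using b_dec norm_E_mono by blast
  moreover have "0 \<le> F n" for n by (simp add: F_def)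
  ultimately have "convergent F" using decseq_convergent[of F 0] convergent_def by metis
  then have "Cauchy F" by (rule convergent_Cauchy)
  have "Cauchy (\<lambda>n. E (b n) x)"
  proof (rule CauchyI)
    fix e :: real assume e: "0 < e"
    then obtain N where N: "\<And>m n. m \<ge> N \<Longrightarrow> n \<ge> N \<Longrightarrow> norm (F m - F n) < e\<^sup>2"
      using CauchyD[OF \<open>Cauchy F\<close>, of "e\<^sup>2"] by auto
    have less: "norm (E (b m) x - E (b n) x) < e" if "m \<ge> N" "n \<ge> m" for m n
    proof -
      have "(norm (E (b m) x - E (b n) x))\<^sup>2 < e\<^sup>2"
        using N[of m n] that norm_E_diff[OF b_dec[OF that(2)]] by (simp add: F_def)
      then show ?thesis using e by (simp add: power_less_imp_less_base)
    qed
    then have "norm (E (b m) x - E (b n) x) < e" if "m \<ge> N" "n \<ge> N" for m n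
      using that by (metis less nle_le norm_minus_commute)
    then show "\<exists>M. \<forall>m\<ge>M. \<forall>n\<ge>M. norm (E (b m) x - E (b n) x) < e" by blast
  qed
  then obtain v where v: "(\<lambda>n. E (b n) x) \<longlonglongrightarrow> v"
    using Cauchy_convergent_iff convergent_def by blast
  have Ev: "(\<lambda>n. E c (E (b n) x)) \<longlonglongrightarrow> E c v" for c
    by (intro blinfun.tendsto tendsto_const v)
  have fix_v: "E c v = v" if "c > a" for c
  proof -
    obtain N where N: "inverse (real (Suc N)) < c - a" using reals_Archimedean[of "c - a"] \<open>c > a\<close> by auto
    have "E c (E (b n) x) = E (b n) x" if "n \<ge> N" for n
      using N b_dec[OF that] unfolding b_def by (intro E_absorb) linarith
    then have "(\<lambda>n. E c (E (b n) x)) \<longlonglongrightarrow> v"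
      using v by (elim Lim_transform_eventually) (auto intro!: eventually_sequentiallyI[of N])
    then show ?thesis using Ev LIMSEQ_unique by blast
  qed
  define w where "w = v - E a v"
  have w0: "E a w = 0" by (simp add: w_def blinfun.diff_right E_idem)
  have "rinner (T w) w \<le> a * (norm w)\<^sup>2"
  proof (rule field_le_epsilon)
    fix e :: real assume e: "e > 0"
    define c where "c = a + e / ((norm w)\<^sup>2 + 1)"
    have c: "c > a" using e by (simp add: c_def add_nonneg_pos)
    have "E c w = w" using c by (simp add: w_def blinfun.diff_right fix_v E_absorb)
    then have "rinner (T w) w \<le> c * (norm w)\<^sup>2" by (rule E_upper)
    also have "\<dots> \<le> a * (norm w)\<^sup>2 + e"
    proof -
      have "e / (n + 1) * n \<le> e" if "n \<ge> 0" for n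
        using e that by (simp add: field_simps)
      then have "e / ((norm w)\<^sup>2 + 1) * (norm w)\<^sup>2 \<le> e" by simp
      then show ?thesis by (simp add: c_def distrib_right)
    qed
    finally show "rinner (T w) w \<le> a * (norm w)\<^sup>2 + e" .
  qed
  then have "w = 0" using E_lower[OF w0] E_strict[OF w0] by simp
  then have "E a v = v" by (simp add: w_def)
  moreover have "E a (E (b n) x) = E a x" for n
    using E_absorb[of a "b n" x] by (simp add: E_commute[of a] b_def)
  then have "E a v = E a x" using Ev[of a] by (simp add: LIMSEQ_const_iff)
  ultimately show ?thesis using v by (simp add: b_def)
qed

lemma E_eq_0:
  assumes "\<And>x. l * (norm x)\<^sup>2 \<le> rinner (T x) x" and "a < l"
  shows "E a x = 0"
proof -
  have "l * (norm (E a x))\<^sup>2 \<le> a * (norm (E a x))\<^sup>2"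
    using assms(1)[of "E a x"] E_upper[OF E_idem, of a x] by linarith
  then have "(l - a) * (norm (E a x))\<^sup>2 \<le> 0" by (simp add: algebra_simps)
  then show ?thesis using assms(2) by (simp add: mult_le_0_iff)
qed

lemma E_eq_id:
  assumes "\<And>x. rinner (T x) x \<le> u * (norm x)\<^sup>2" and "u < a"
  shows "E a x = x"
proof -
  define z where "z = x - E a x"
  have "E a z = 0" by (simp add: z_def blinfun.diff_right E_idem)
  then have "a * (norm z)\<^sup>2 \<le> u * (norm z)\<^sup>2" using assms(1)[of z] E_lower[of a z] by linarith
  then have "(a - u) * (norm z)\<^sup>2 \<le> 0" by (simp add: algebra_simps)
  then show ?thesis using assms(2) by (simp add: mult_le_0_iff z_def)
qed

lemma T_lower: "- norm T * (norm x)\<^sup>2 \<le> rinner (T x) x"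
  and T_upper: "rinner (T x) x \<le> norm T * (norm x)\<^sup>2"
  using abs_rinner_le[of T x] by auto

definition \<mu> :: "'a \<Rightarrow> real measure" where
  "\<mu> x = interval_measure (\<lambda>a. (norm (E a x))\<^sup>2)"

lemma sets_\<mu> [simp, measurable_cong]: "sets (\<mu> x) = sets borel"
  and space_\<mu> [simp]: "space (\<mu> x) = UNIV"
  by (simp_all add: \<mu>_def)

lemma emeasure_\<mu>_Ioc:
  assumes "a \<le> b"
  shows "emeasure (\<mu> x) {a<..b} = (norm (E b x))\<^sup>2 - (norm (E a x))\<^sup>2"
  unfolding \<mu>_def
proof (rule emeasure_interval_measure_Ioc[OF assms])
  fix c
  show "continuous (at_right c) (\<lambda>a. (norm (E a x))\<^sup>2)"
  proof (subst continuous_at_right_real_increasing[OF norm_E_mono], assumption, intro allI impI)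
    fix e :: real assume e: "0 < e"
    have "(\<lambda>n. (norm (E (c + inverse (real (Suc n))) x))\<^sup>2) \<longlonglongrightarrow> (norm (E c x))\<^sup>2"
      by (intro tendsto_intros E_right_continuous)
    then have "\<forall>\<^sub>F n in sequentially. (norm (E (c + inverse (real (Suc n))) x))\<^sup>2 < (norm (E c x))\<^sup>2 + e"
      by (rule order_tendstoD) (simp add: e)
    then obtain n where "(norm (E (c + inverse (real (Suc n))) x))\<^sup>2 < (norm (E c x))\<^sup>2 + e"
      using eventually_happens trivial_limit_sequentially by blast
    then show "\<exists>\<delta>>0. (norm (E (c + \<delta>) x))\<^sup>2 - (norm (E c x))\<^sup>2 < e"
      by (intro exI[of _ "inverse (real (Suc n))"]) simp
  qed
qed (rule norm_E_mono)

lemma emeasure_\<mu>_atMost: "emeasure (\<mu> x) {..a} = (norm (E a x))\<^sup>2"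
proof -
  have "(\<lambda>n. emeasure (\<mu> x) {- real n<..a}) \<longlonglongrightarrow> emeasure (\<mu> x) (\<Union>n. {- real n<..a})"
    by (rule Lim_emeasure_incseq) (auto simp: incseq_def)
  moreover have "(\<Union>n. {- real n<..a}) = {..a}"
  proof -
    have "\<exists>n. - real n < t" for t using reals_Archimedean2[of "-t"] by (metis minus_less_iff)
    then show ?thesis by auto
  qed
  moreover have "\<forall>\<^sub>F n in sequentially. emeasure (\<mu> x) {- real n<..a} = (norm (E a x))\<^sup>2"
  proof -
    obtain N where N: "real N > norm T + \<bar>a\<bar>" using reals_Archimedean2 by blast
    have "emeasure (\<mu> x) {- real n<..a} = (norm (E a x))\<^sup>2" if "n \<ge> N" for n
    proof -
      have "real n \<ge> real N" using that by simp
      then have n: "- real n < - norm T" "- real n \<le> a" using N norm_ge_zero[of T] by linarith+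
      then have "E (- real n) x = 0" by (intro E_eq_0[OF T_lower])
      then show ?thesis using n by (simp add: emeasure_\<mu>_Ioc)
    qed
    then show ?thesis by (auto simp: eventually_sequentially)
  qed
  then have "(\<lambda>n. emeasure (\<mu> x) {- real n<..a}) \<longlonglongrightarrow> ennreal ((norm (E a x))\<^sup>2)"
    by (rule tendsto_eventually)
  ultimately show ?thesis using LIMSEQ_unique by metis
qed

lemma emeasure_\<mu>_UNIV: "emeasure (\<mu> x) UNIV = (norm x)\<^sup>2"
proof -
  have "(\<lambda>n. emeasure (\<mu> x) {..real n}) \<longlonglongrightarrow> emeasure (\<mu> x) (\<Union>n. {..real n})"
    by (rule Lim_emeasure_incseq) (auto simp: incseq_def)
  moreover have "(\<Union>n. {..real n}) = UNIV" using real_arch_simple by auto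
  moreover have "\<forall>\<^sub>F n in sequentially. emeasure (\<mu> x) {..real n} = (norm x)\<^sup>2"
  proof -
    obtain N where N: "real N > norm T" using reals_Archimedean2 by blast
    have "emeasure (\<mu> x) {..real n} = (norm x)\<^sup>2" if "n \<ge> N" for n
    proof -
      have "real n > norm T" using that N by linarith
      then show ?thesis by (simp add: emeasure_\<mu>_atMost E_eq_id[OF T_upper])
    qed
    then show ?thesis by (auto simp: eventually_sequentially)
  qed
  then have "(\<lambda>n. emeasure (\<mu> x) {..real n}) \<longlonglongrightarrow> ennreal ((norm x)\<^sup>2)"
    by (rule tendsto_eventually)
  ultimately show ?thesis using LIMSEQ_unique by metis
qed

lemma finite_measure_\<mu>: "finite_measure (\<mu> x)"
  by (rule finite_measureI) (simp add: emeasure_\<mu>_UNIV)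

lemma measure_\<mu>_UNIV: "measure (\<mu> x) UNIV = (norm x)\<^sup>2"
  by (simp add: measure_def emeasure_\<mu>_UNIV)

lemma measure_\<mu>_atMost: "measure (\<mu> x) {..a} = (norm (E a x))\<^sup>2"
  by (simp add: measure_def emeasure_\<mu>_atMost)

lemma measure_\<mu>_compl:
  "S \<in> sets borel \<Longrightarrow> measure (\<mu> x) (UNIV - S) = (norm x)\<^sup>2 - measure (\<mu> x) S"
  using finite_measure.finite_measure_compl[OF finite_measure_\<mu>, of S x] by (simp add: measure_\<mu>_UNIV)

lemma AE_\<mu>_bounds:
  assumes l: "\<And>x. l * (norm x)\<^sup>2 \<le> rinner (T x) x" and u: "\<And>x. rinner (T x) x \<le> u * (norm x)\<^sup>2"
  shows "AE t in \<mu> x. t \<in> {l..u}"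
proof -
  have "AE t in \<mu> x. l - inverse (real (Suc n)) < t \<and> t \<le> u + inverse (real (Suc n))" for n
  proof -
    have "emeasure (\<mu> x) {..l - inverse (real (Suc n))} = 0"
      by (simp add: emeasure_\<mu>_atMost E_eq_0[OF l])
    then have "AE t in \<mu> x. \<not> t \<in> {..l - inverse (real (Suc n))}"
      by (intro AE_not_in) (simp add: null_sets_def)
    moreover have "measure (\<mu> x) (UNIV - {..u + inverse (real (Suc n))}) = 0"
      by (simp add: measure_\<mu>_compl measure_\<mu>_atMost E_eq_id[OF u] del: Compl_eq_Diff_UNIV)
    then have "AE t in \<mu> x. \<not> t \<in> UNIV - {..u + inverse (real (Suc n))}"
      by (intro AE_not_in)
        (simp add: null_sets_def finite_measure.emeasure_eq_measure[OF finite_measure_\<mu>])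
    ultimately show ?thesis by eventually_elim auto
  qed
  then have "AE t in \<mu> x. \<forall>n. l - inverse (real (Suc n)) < t \<and> t \<le> u + inverse (real (Suc n))"
    by (simp add: AE_all_countable)
  then show ?thesis
  proof eventually_elim
    case (elim t)
    have "(\<lambda>n. l - inverse (real (Suc n))) \<longlonglongrightarrow> l - 0" "(\<lambda>n. u + inverse (real (Suc n))) \<longlonglongrightarrow> u + 0"
      by (intro tendsto_intros LIMSEQ_inverse_real_of_nat)+
    then have "l - 0 \<le> t" "t \<le> u + 0"
      using elim by (auto intro: LIMSEQ_le_const LIMSEQ_le_const2 less_imp_le)
    then show ?case by simp
  qed
qed

end


section \<open>Existence of the spectral measure\<close>

context spectral_family
begin

definition represents :: "real set \<Rightarrow> 'a endo \<Rightarrow> bool" where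
  "represents S Q \<longleftrightarrow> proj_op Q \<and> bounded_op Q \<and> (\<forall>x. measure (\<mu> x) S = (norm (Q x))\<^sup>2)"

lemma represents_orthogonal:
  assumes Q: "represents S Q" "represents S' Q'" and S: "S \<in> sets borel" "S' \<in> sets borel"
    and disj: "S \<inter> S' = {}"
  shows "Q' (Q x) = 0"
proof -
  have "measure (\<mu> (Q x)) S + measure (\<mu> (Q x)) S' = measure (\<mu> (Q x)) (S \<union> S')"
    using S disj by (intro finite_measure.finite_measure_Union[OF finite_measure_\<mu>, symmetric]) auto
  also have "\<dots> \<le> (norm (Q x))\<^sup>2"
    using finite_measure.bounded_measure[OF finite_measure_\<mu>, of "Q x"] by (simp add: measure_\<mu>_UNIV)
  finally have "(norm (Q (Q x)))\<^sup>2 + (norm (Q' (Q x)))\<^sup>2 \<le> (norm (Q x))\<^sup>2"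
    using Q by (simp add: represents_def)
  then show ?thesis using Q by (simp add: represents_def proj_op_idem)
qed

lemma represents_compl:
  assumes "represents S Q" "S \<in> sets borel"
  shows "represents (UNIV - S) (id_blinfun - Q)"
proof -
  have Q: "proj_op Q" "bounded_op Q" and m: "\<And>x. measure (\<mu> x) S = (norm (Q x))\<^sup>2"
    using assms by (auto simp: represents_def)
  have "measure (\<mu> x) (UNIV - S) = (norm ((id_blinfun - Q) x))\<^sup>2" for x
    using proj_op_pythagoras[OF Q(1), of x] measure_\<mu>_compl[OF assms(2), of x] m[of x]
    by (simp add: blinfun.diff_left)
  then show ?thesis by (simp add: represents_def proj_op_complement bounded_op_diff Q)
qed

lemma represents_union:
  fixes F :: "nat \<Rightarrow> real set"
  assumes Q: "\<And>n. represents (F n) (Q n)" and F: "\<And>n. F n \<in> sets borel" "disjoint_family F"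
  obtains P where "represents (\<Union>n. F n) P" "\<And>x. (\<lambda>n. Q n x) sums P x"
proof -
  have projQ: "proj_op (Q n)" and bddQ: "bounded_op (Q n)" for n using Q by (auto simp: represents_def)
  have "Q m (Q n x) = 0" if "m \<noteq> n" for m n x
    using represents_orthogonal[OF Q Q F(1) F(1)] disjoint_family_onD[OF F(2)] that by blast
  then obtain P where P: "proj_op P" and sums: "\<And>x. (\<lambda>n. Q n x) sums P x"
    using proj_op_series[of Q] projQ by blast
  have "P (c *\<^sub>C x) = c *\<^sub>C P x" for c x
  proof -
    have "(\<lambda>n. c *\<^sub>C Q n x) sums (c *\<^sub>C P x)"
      by (rule bounded_linear.sums[OF bounded_linear_scaleC sums])
    then show ?thesis
      using sums[of "c *\<^sub>C x"] sums_unique2 by (simp add: bounded_op_scaleC[OF bddQ])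
  qed
  moreover have "measure (\<mu> x) (\<Union>n. F n) = (norm (P x))\<^sup>2" for x
  proof -
    have "(\<lambda>n. measure (\<mu> x) (F n)) sums measure (\<mu> x) (\<Union>n. F n)"
      using F by (intro finite_measure.finite_measure_UNION[OF finite_measure_\<mu>]) auto
    moreover have "(\<lambda>n. rinner (Q n x) x) sums rinner (P x) x"
      by (rule bounded_linear.sums[OF rinner.bounded_linear_left sums])
    then have "(\<lambda>n. measure (\<mu> x) (F n)) sums (norm (P x))\<^sup>2"
      using Q by (simp add: represents_def proj_op_quadratic[OF projQ] proj_op_quadratic[OF P])
    ultimately show ?thesis using sums_unique2 by blast
  qed
  ultimately have "represents (\<Union>n. F n) P" using P by (simp add: represents_def bounded_op_def)
  then show ?thesis using that sums by blast
qed

text \<open>The sets whose measures are given by a projection form a Dynkin system, since projections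
  that represent disjoint sets are automatically orthogonal; and it contains the half-lines,
  which generate the Borel sets and are closed under intersection.\<close>

lemma ex_represents:
  assumes "S \<in> sets borel"
  shows "\<exists>Q. represents S Q"
proof -
  have borel_eq: "sets (borel :: real measure) = sigma_sets UNIV (range (\<lambda>a. {..a}))"
    unfolding borel_eq_atMost by (rule sets_measure_of) simp
  have "Int_stable (range (\<lambda>a::real. {..a}))" by (auto simp: Int_stable_def)
  moreover have "range (\<lambda>a::real. {..a}) \<subseteq> Pow UNIV" by simp
  moreover have "S \<in> sigma_sets UNIV (range (\<lambda>a. {..a}))" using assms by (simp add: borel_eq)
  ultimately show ?thesis
  proof (induction rule: sigma_sets_induct_disjoint)
    case (basic A)
    then obtain a where "A = {..a}" by blast
    then have "represents A (E a)" by (simp add: represents_def proj_E bounded_op_E measure_\<mu>_atMost)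
    then show ?case by blast
  next
    case empty
    have "represents {} 0" by (simp add: represents_def proj_op_def)
    then show ?case by blast
  next
    case (compl A)
    then show ?case using represents_compl by (metis borel_eq)
  next
    case (union A)
    then obtain Q where Q: "\<And>n. represents (A n) (Q n)" by metis
    have "A n \<in> sets borel" for n using union(2) borel_eq by blast
    then obtain P where "represents (\<Union>n. A n) P"
      using represents_union[OF Q _ union(1)] by blast
    then show ?case by blast
  qed
qed

definition G :: "real set \<Rightarrow> 'a endo" where
  "G S = (SOME Q. represents S Q)"

lemma represents_G: "S \<in> sets borel \<Longrightarrow> represents S (G S)"
  unfolding G_def by (rule someI_ex[OF ex_represents])

lemma proj_G: "S \<in> sets borel \<Longrightarrow> proj_op (G S)"
  using represents_G by (simp add: represents_def)

lemma G_unique: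
  assumes "S \<in> sets borel" "represents S Q"
  shows "G S = Q"
  using assms represents_G[OF assms(1)]
  by (intro symmetric_eqI) (simp_all add: represents_def proj_op_symmetric proj_op_quadratic)

lemma G_union:
  assumes S: "S \<in> sets borel" "S' \<in> sets borel" "S \<inter> S' = {}"
  shows "G (S \<union> S') = G S + G S'"
proof (rule symmetric_eqI)
  fix x
  have "measure (\<mu> x) (S \<union> S') = measure (\<mu> x) S + measure (\<mu> x) S'"
    using S by (intro finite_measure.finite_measure_Union[OF finite_measure_\<mu>]) auto
  then show "rinner (G (S \<union> S') x) x = rinner ((G S + G S') x) x"
    using S represents_G[of S] represents_G[of S'] represents_G[of "S \<union> S'"]
    by (simp add: blinfun.add_left rinner.add_left represents_def proj_op_quadratic)
qed (use S in \<open>simp_all add: symmetric_add proj_op_symmetric proj_G\<close>)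

lemma G_inter:
  assumes S: "S \<in> sets borel" "S' \<in> sets borel"
  shows "G (S \<inter> S') = G S o\<^sub>L G S'"
proof (rule blinfun_eqI)
  fix x
  have orth: "G A (G B x) = 0" if "A \<in> sets borel" "B \<in> sets borel" "A \<inter> B = {}" for A B x
    using represents_orthogonal[OF represents_G represents_G] that by (metis inf_commute)
  have GS: "G S = G (S \<inter> S') + G (S - S')" and GS': "G S' = G (S \<inter> S') + G (S' - S)"
  proof -
    have "G ((S \<inter> S') \<union> (S - S')) = G (S \<inter> S') + G (S - S')"
      "G ((S \<inter> S') \<union> (S' - S)) = G (S \<inter> S') + G (S' - S)"
      by (rule G_union; use S in blast)+
    moreover have "(S \<inter> S') \<union> (S - S') = S" "(S \<inter> S') \<union> (S' - S) = S'" by blast+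
    ultimately show "G S = G (S \<inter> S') + G (S - S')" "G S' = G (S \<inter> S') + G (S' - S)" by simp_all
  qed
  have "G (S \<inter> S') (G (S \<inter> S') x) = G (S \<inter> S') x"
    using S by (intro proj_op_idem proj_G) auto
  moreover have "G (S - S') (G (S \<inter> S') x) = 0" "G (S \<inter> S') (G (S' - S) x) = 0"
    "G (S - S') (G (S' - S) x) = 0"
    using S by (auto intro!: orth)
  ultimately show "G (S \<inter> S') x = (G S o\<^sub>L G S') x"
    unfolding blinfun_apply_blinfun_compose
    by (subst GS, subst GS') (simp add: blinfun.add_left blinfun.add_right)
qed

lemma projection_valued_measure_G: "projection_valued_measure G"
  unfolding projection_valued_measure_def
proof (intro conjI ballI allI impI)
  show "orth_projection (G S)" if "S \<in> sets borel" for S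
    using represents_G[OF that] by (simp add: orth_projection_iff represents_def)
  have "represents UNIV id_blinfun"
    by (simp add: represents_def proj_op_def measure_\<mu>_UNIV)
  then show "G UNIV = id_blinfun" by (intro G_unique) auto
  show "G (S \<inter> S') = G S o\<^sub>L G S'" if "S \<in> sets borel" "S' \<in> sets borel" for S S'
    using that by (rule G_inter)
  fix F :: "nat \<Rightarrow> real set" and x assume F: "range F \<subseteq> sets borel \<and> disjoint_family F"
  then have F': "\<And>n. F n \<in> sets borel" "disjoint_family F" by auto
  obtain P where "represents (\<Union>n. F n) P" "\<And>x. (\<lambda>n. G (F n) x) sums P x"
    using represents_union[OF represents_G[OF F'(1)] F'] by blast
  moreover have "(\<Union>n. F n) \<in> sets borel" using F' by auto
  ultimately show "(\<lambda>n. G (F n) x) sums G (\<Union>n. F n) x" using G_unique by metis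
qed

end

text \<open>Bisecting the interval \<open>n\<close> times improves the bound on the increments by a factor of
  \<open>2\<^sup>n\<close>, because the increments of \<open>F\<close> add up.\<close>

lemma eq_if_increments_quadratic:
  fixes D F :: "real \<Rightarrow> real"
  assumes D: "\<And>a b. u \<le> a \<Longrightarrow> a \<le> b \<Longrightarrow> b \<le> v \<Longrightarrow> \<bar>D b - D a\<bar> \<le> (b - a) * (F b - F a)"
    and uv: "u \<le> v"
  shows "D u = D v"
proof -
  have step: "\<bar>D b - D a\<bar> \<le> (b - a) * (F b - F a) / 2 ^ n" if "u \<le> a" "a \<le> b" "b \<le> v" for a b n
    using that
  proof (induction n arbitrary: a b)
    case (Suc n)
    define c where "c = (a + b) / 2"
    have c: "a \<le> c" "c \<le> b" "c - a = (b - a) / 2" "b - c = (b - a) / 2"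
      using Suc.prems by (auto simp: c_def field_simps)
    have "\<bar>D b - D a\<bar> \<le> \<bar>D b - D c\<bar> + \<bar>D c - D a\<bar>" by simp
    also have "\<dots> \<le> (b - c) * (F b - F c) / 2 ^ n + (c - a) * (F c - F a) / 2 ^ n"
      using Suc c by (intro add_mono Suc.IH) auto
    also have "\<dots> = (b - a) * (F b - F a) / 2 ^ Suc n"
      unfolding c(3,4) by (simp add: field_simps)
    finally show ?case .
  qed (use D in simp)
  have "(\<lambda>n. (v - u) * (F v - F u) * (1/2) ^ n) \<longlonglongrightarrow> (v - u) * (F v - F u) * 0"
    by (intro tendsto_intros LIMSEQ_power_zero) simp
  then have "\<bar>D v - D u\<bar> \<le> (v - u) * (F v - F u) * 0"
    using step[of u v] uv by (intro LIMSEQ_le_const) (auto simp: power_divide)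
  then show ?thesis by simp
qed

lemma (in spectral_family) set_integrable_id_\<mu>: "set_integrable (\<mu> x) {a<..b} (\<lambda>t. t)"
  unfolding set_integrable_def
proof (rule finite_measure.integrable_const_bound[OF finite_measure_\<mu>, where B = "\<bar>a\<bar> + \<bar>b\<bar>"])
  show "AE t in \<mu> x. norm (indicat_real {a<..b} t *\<^sub>R t) \<le> \<bar>a\<bar> + \<bar>b\<bar>"
    by (intro always_eventually) (auto simp: indicator_def)
qed measurable

lemma (in spectral_family) integral_id_Ioc_bounds:
  assumes "a \<le> b"
  shows "a * ((norm (E b x))\<^sup>2 - (norm (E a x))\<^sup>2) \<le> (LINT t:{a<..b}|\<mu> x. t)"
    and "(LINT t:{a<..b}|\<mu> x. t) \<le> b * ((norm (E b x))\<^sup>2 - (norm (E a x))\<^sup>2)"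
proof -
  have m: "measure (\<mu> x) {a<..b} = (norm (E b x))\<^sup>2 - (norm (E a x))\<^sup>2"
    using norm_E_mono[OF assms, of x] by (simp add: measure_def emeasure_\<mu>_Ioc[OF assms])
  have const: "(LINT t:{a<..b}|\<mu> x. c) = c * measure (\<mu> x) {a<..b}"
    and int: "set_integrable (\<mu> x) {a<..b} (\<lambda>_. c)" for c :: real
    using finite_measure.emeasure_finite[OF finite_measure_\<mu>]
    by (auto simp: set_lebesgue_integral_def set_integrable_def less_top)
  show "a * ((norm (E b x))\<^sup>2 - (norm (E a x))\<^sup>2) \<le> (LINT t:{a<..b}|\<mu> x. t)"
    unfolding m[symmetric] const[symmetric]
    by (rule set_integral_mono[OF int set_integrable_id_\<mu>]) auto
  show "(LINT t:{a<..b}|\<mu> x. t) \<le> b * ((norm (E b x))\<^sup>2 - (norm (E a x))\<^sup>2)"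
    unfolding m[symmetric] const[symmetric]
    by (rule set_integral_mono[OF set_integrable_id_\<mu> int]) auto
qed

text \<open>On the range of \<open>E b - E a\<close> both \<open>T\<close> and the integral of the identity lie between
  \<open>a\<close> and \<open>b\<close>, so that their difference has increments as in \<open>eq_if_increments_quadratic\<close>.\<close>

lemma (in spectral_family) quadratic_eq_integral: "rinner (T x) x = (\<integral>t. t \<partial>\<mu> x)"
proof -
  define r where "r = norm T + 1"
  define F where "F a = (norm (E a x))\<^sup>2" for a
  define D where "D a = rinner (T (E a x)) (E a x) - (LINT t:{-r<..a}|\<mu> x. t)" for a
  have "D (-r) = D r"
  proof (rule eq_if_increments_quadratic[where D = D and F = F and u = "-r" and v = r])
    fix a b assume ab: "-r \<le> a" "a \<le> b" "b \<le> r"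
    define z where "z = E b x - E a x"
    have Eaz: "E a z = 0" and Ebz: "E b z = z"
      using ab by (simp_all add: z_def blinfun.diff_right E_idem E_absorb E_commute[of a b])
    have "rinner (T (E a x)) z = rinner (T x) (E a z)"
      using symmetricD[OF proj_op_symmetric[OF proj_E]] by (simp add: T_E)
    then have "rinner (T (E b x)) (E b x) = rinner (T (E a x)) (E a x) + rinner (T z) z"
      using rinner_quadratic_add[OF symmetric_T, of "E a x" z] Eaz by (simp add: z_def rinner.zero_right)
    moreover have "(LINT t:{-r<..b}|\<mu> x. t) = (LINT t:{-r<..a}|\<mu> x. t) + (LINT t:{a<..b}|\<mu> x. t)"
    proof -
      have "{-r<..b} = {-r<..a} \<union> {a<..b}" using ab by auto
      then show ?thesis
        by (simp only:) (intro set_integral_Un set_integrable_id_\<mu>, auto)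
    qed
    ultimately have "D b - D a = rinner (T z) z - (LINT t:{a<..b}|\<mu> x. t)" by (simp add: D_def)
    moreover have "(norm z)\<^sup>2 = F b - F a" using norm_E_diff[OF ab(2)] by (simp add: z_def F_def)
    then have "a * (F b - F a) \<le> rinner (T z) z" "rinner (T z) z \<le> b * (F b - F a)"
      using E_lower[OF Eaz] E_upper[OF Ebz] by simp_all
    moreover note integral_id_Ioc_bounds[OF ab(2), of x, folded F_def]
    ultimately show "\<bar>D b - D a\<bar> \<le> (b - a) * (F b - F a)"
      by (simp add: left_diff_distrib abs_le_iff)
  qed (simp add: r_def)
  moreover have "E (-r) x = 0" by (rule E_eq_0[OF T_lower]) (simp add: r_def)
  then have "D (-r) = 0" by (simp add: D_def rinner.zero_right set_lebesgue_integral_def)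
  moreover have "E r x = x" by (rule E_eq_id[OF T_upper]) (simp add: r_def)
  ultimately have "rinner (T x) x = (LINT t:{-r<..r}|\<mu> x. t)" by (simp add: D_def)
  also have "\<dots> = (\<integral>t. t \<partial>\<mu> x)"
    unfolding set_lebesgue_integral_def
  proof (rule integral_cong_AE)
    show "AE t in \<mu> x. indicat_real {- r<..r} t *\<^sub>R t = t"
      using AE_\<mu>_bounds[OF T_lower T_upper, of x]
      by eventually_elim (auto simp: indicator_def r_def)
  qed measurable
  finally show ?thesis .
qed

lemma symmetric_cinner:
  assumes "bounded_op T" "symmetric T"
  shows "cinner (T x) x = complex_of_real (rinner (T x) x)"
proof -
  have "cinner (T x) x = cinner x (T x)"
    using assms by (intro cinner_adjointI) (simp_all add: symmetric_def)
  then have "cinner (T x) x \<in> \<real>" by (metis Reals_cnj_iff cinner_commute)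
  then show ?thesis by (simp add: rinner_def complex_is_Real_iff complex_eq_iff)
qed

lemma measure_of_eq_measure:
  assumes "sets M = sets borel" "\<And>S. S \<in> sets borel \<Longrightarrow> f S = emeasure M S"
  shows "measure_of UNIV (sets borel) f = (M :: real measure)"
proof -
  have "measure_of UNIV (sets borel) f = measure_of UNIV (sets borel) (emeasure M)"
    by (rule measure_of_eq) (auto simp: assms(2) sets.sigma_sets_eq[of borel, simplified])
  also have "\<dots> = M"
    using measure_of_of_measure[of M] assms(1) sets_eq_imp_space_eq[OF assms(1)] by simp
  finally show ?thesis .
qed

lemma (in spectral_family) diagonal_measure_G: "diagonal_measure G x = \<mu> x"
  unfolding diagonal_measure_def
proof (rule measure_of_eq_measure)
  fix S :: "real set" assume "S \<in> sets borel"
  then show "ennreal (Re (cinner (G S x) x)) = emeasure (\<mu> x) S"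
    using represents_G[of S]
    by (simp add: Re_cinner proj_op_quadratic represents_def
        finite_measure.emeasure_eq_measure[OF finite_measure_\<mu>])
qed simp

lemma (in spectral_family) spectral_measure_G: "spectral_measure T G"
  unfolding spectral_measure_def
proof (intro conjI allI exI)
  show "projection_valued_measure G" by (rule projection_valued_measure_G)
  show "cinner (T x) x = complex_of_real (\<integral>t. t \<partial>diagonal_measure G x)" for x
    by (simp add: diagonal_measure_G symmetric_cinner[OF bounded_op_T symmetric_T] quadratic_eq_integral)
  have "measure (\<mu> x) {- norm T..norm T} = (norm x)\<^sup>2" for x
  proof -
    have "measure (\<mu> x) {- norm T..norm T} = measure (\<mu> x) UNIV"
      by (rule finite_measure.finite_measure_eq_AE[OF finite_measure_\<mu>])
        (use AE_\<mu>_bounds[OF T_lower T_upper, of x] in auto)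
    then show ?thesis by (simp add: measure_\<mu>_UNIV)
  qed
  then have "represents {- norm T..norm T} id_blinfun" by (simp add: represents_def proj_op_def)
  then show "G {- norm T..norm T} = id_blinfun" by (intro G_unique) auto
qed


section \<open>Uniqueness of the spectral measure\<close>

locale spectral_resolution =
  fixes T :: "'a::complex_hilbert_space endo" and G :: "real set \<Rightarrow> 'a endo"
  assumes bounded_op_T: "bounded_op T" and symmetric_T: "symmetric T"
    and spectral_measure: "spectral_measure T G"
begin

lemma pvm: "projection_valued_measure G"
  using spectral_measure by (simp add: spectral_measure_def)

lemma proj_G: "S \<in> sets borel \<Longrightarrow> proj_op (G S)"
  using pvm by (simp add: projection_valued_measure_def orth_projection_iff)

lemma G_UNIV: "G UNIV = id_blinfun"
  using pvm by (simp add: projection_valued_measure_def)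

lemma G_inter: "S \<in> sets borel \<Longrightarrow> S' \<in> sets borel \<Longrightarrow> G S (G S' x) = G (S \<inter> S') x"
  using pvm by (simp add: projection_valued_measure_def)

lemma G_sums:
  "range F \<subseteq> sets borel \<Longrightarrow> disjoint_family F \<Longrightarrow> (\<lambda>n::nat. G (F n) x) sums G (\<Union>n. F n) x"
  using pvm by (simp add: projection_valued_measure_def)

lemma G_empty: "G {} x = 0"
proof -
  have "(\<lambda>n::nat. G {} x) sums G (\<Union>n::nat. {}) x"
    by (rule G_sums) (auto simp: disjoint_family_on_def)
  then show ?thesis using summable_LIMSEQ_zero[OF sums_summable] LIMSEQ_const_iff by blast
qed

lemma G_disjoint:
  "S \<in> sets borel \<Longrightarrow> S' \<in> sets borel \<Longrightarrow> S \<inter> S' = {} \<Longrightarrow> G S (G S' x) = 0"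
  by (simp add: G_inter G_empty)

abbreviation \<nu> :: "'a \<Rightarrow> real measure" where
  "\<nu> \<equiv> diagonal_measure G"

lemma sets_\<nu> [simp, measurable_cong]: "sets (\<nu> x) = sets borel"
  and space_\<nu> [simp]: "space (\<nu> x) = UNIV"
  using sets.sigma_sets_eq[of "borel :: real measure"]
  by (simp_all add: diagonal_measure_def sets_measure_of_conv space_measure_of_conv)

lemma emeasure_\<nu>:
  assumes "S \<in> sets borel"
  shows "emeasure (\<nu> x) S = (norm (G S x))\<^sup>2"
proof -
  let ?m = "\<lambda>S. ennreal (Re (cinner (G S x) x))"
  have m: "?m S = (norm (G S x))\<^sup>2" if "S \<in> sets borel" for S
    using proj_op_quadratic[OF proj_G[OF that]] by (simp add: Re_cinner)
  have "sigma_algebra UNIV (sets (borel :: real measure))"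
    using sets.sigma_algebra_axioms[of "borel :: real measure"] by simp
  moreover have "positive (sets borel) ?m"
    by (simp add: positive_def G_empty Re_cinner rinner.zero_left)
  moreover have "countably_additive (sets borel) ?m"
    unfolding countably_additive_def
  proof (intro allI impI)
    fix F :: "nat \<Rightarrow> real set"
    assume F: "range F \<subseteq> sets borel" "disjoint_family F"
    have "(\<lambda>n. rinner (G (F n) x) x) sums rinner (G (\<Union>n. F n) x) x"
      by (rule bounded_linear.sums[OF rinner.bounded_linear_left G_sums[OF F]])
    moreover have "0 \<le> rinner (G (F n) x) x" for n
      using F proj_op_quadratic[OF proj_G] by (simp add: range_subsetD)
    ultimately show "(\<Sum>n. ?m (F n)) = ?m (\<Union>n. F n)"
      unfolding Re_cinner by (intro suminf_ennreal_eq)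
  qed
  ultimately show ?thesis
    unfolding diagonal_measure_def using assms m by (simp add: emeasure_measure_of_sigma)
qed

lemma finite_measure_\<nu>: "finite_measure (\<nu> x)"
  by (rule finite_measureI) (simp add: emeasure_\<nu>)

lemma measure_\<nu>: "S \<in> sets borel \<Longrightarrow> measure (\<nu> x) S = (norm (G S x))\<^sup>2"
  by (simp add: measure_def emeasure_\<nu>)

lemma AE_\<nu>_in:
  assumes S: "S \<in> sets borel" and x: "G S x = x"
  shows "AE t in \<nu> x. t \<in> S"
proof -
  have "G (UNIV - S) x = 0" using G_disjoint[of "UNIV - S" S x] S x by auto
  then have "emeasure (\<nu> x) (UNIV - S) = 0" using S by (simp add: emeasure_\<nu>)
  then have "UNIV - S \<in> null_sets (\<nu> x)" using S by (simp add: null_sets_def)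
  from AE_not_in[OF this] show ?thesis by simp
qed

lemma integrable_id: "integrable (\<nu> x) (\<lambda>t. t)"
proof -
  obtain r where "G {-r..r} = id_blinfun" using spectral_measure by (auto simp: spectral_measure_def)
  then have "AE t in \<nu> x. t \<in> {-r..r}" by (intro AE_\<nu>_in) auto
  then have "AE t in \<nu> x. norm t \<le> r" by eventually_elim auto
  then show ?thesis
    by (intro finite_measure.integrable_const_bound[OF finite_measure_\<nu>]) simp_all
qed

lemma quadratic_eq_integral: "rinner (T x) x = (\<integral>t. t \<partial>\<nu> x)"
  using spectral_measure by (simp add: spectral_measure_def rinner_def)

lemma \<nu>_G:
  assumes S: "S \<in> sets borel"
  shows "\<nu> (G S x) = density (\<nu> x) (\<lambda>t. ennreal (indicat_real S t))"
proof (rule measure_eqI)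
  fix A assume "A \<in> sets (\<nu> (G S x))"
  then have A: "A \<in> sets borel" by simp
  have "emeasure (density (\<nu> x) (indicator S)) A = emeasure (\<nu> x) (S \<inter> A)"
    using S A by (intro emeasure_restricted) auto
  then show "emeasure (\<nu> (G S x)) A = emeasure (density (\<nu> x) (\<lambda>t. ennreal (indicat_real S t))) A"
    using S A by (simp add: emeasure_\<nu> G_inter ennreal_indicator Int_commute)
qed simp

lemma quadratic_split:
  assumes S: "S \<in> sets borel"
  shows "rinner (T x) x =
    rinner (T (G S x)) (G S x) + rinner (T (G (UNIV - S) x)) (G (UNIV - S) x)"
proof -
  have part: "rinner (T (G A x)) (G A x) = (\<integral>t. indicat_real A t * t \<partial>\<nu> x)" if "A \<in> sets borel" for A
    unfolding quadratic_eq_integral \<nu>_G[OF that] using that by (subst integral_density) auto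
  have int: "integrable (\<nu> x) (\<lambda>t. indicat_real A t * t)" if "A \<in> sets borel" for A
    using integrable_mult_indicator[OF _ integrable_id, of A x] that by simp
  have "(\<integral>t. t \<partial>\<nu> x) = (\<integral>t. indicat_real S t * t + indicat_real (UNIV - S) t * t \<partial>\<nu> x)"
    by (intro Bochner_Integration.integral_cong) (auto simp: indicator_def)
  also have "\<dots> = (\<integral>t. indicat_real S t * t \<partial>\<nu> x) + (\<integral>t. indicat_real (UNIV - S) t * t \<partial>\<nu> x)"
    using S by (intro Bochner_Integration.integral_add int) auto
  finally show ?thesis using S by (simp add: quadratic_eq_integral[of x] part)
qed

text \<open>Applied to sums of vectors from the ranges of \<open>G S\<close> and of its complement,
  \<open>quadratic_split\<close> says that \<open>T\<close> maps one range into the orthogonal complement of the other.\<close>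

lemma T_G:
  assumes S: "S \<in> sets borel"
  shows "T (G S x) = G S (T x)"
proof -
  let ?S' = "UNIV - S"
  have S': "?S' \<in> sets borel" using S by auto
  have idem: "G A (G A y) = G A y" if "A \<in> sets borel" for A y by (rule proj_op_idem[OF proj_G[OF that]])
  have disj: "G S (G ?S' y) = 0" "G ?S' (G S y) = 0" for y
    by (rule G_disjoint[OF S S'], blast) (rule G_disjoint[OF S' S], blast)
  have cross: "rinner (T (G S u)) (G ?S' v) = 0" for u v
  proof -
    define w where "w = G S u + G ?S' v"
    have "G S w = G S u" "G ?S' w = G ?S' v"
      using S S' by (simp_all add: w_def blinfun.add_right idem disj)
    then have "rinner (T w) w = rinner (T (G S u)) (G S u) + rinner (T (G ?S' v)) (G ?S' v)"
      using quadratic_split[OF S, of w] by simp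
    then show ?thesis by (simp add: w_def rinner_quadratic_add[OF symmetric_T])
  qed
  have decomp: "G S y + G ?S' y = y" for y
  proof -
    have "(norm (y - G S y - G ?S' y))\<^sup>2 = 0"
    proof -
      define z where "z = y - G S y - G ?S' y"
      have "G S z = 0" "G ?S' z = 0"
        using S S' by (simp_all add: z_def blinfun.diff_right idem disj)
      then have "emeasure (\<nu> z) S = 0" "emeasure (\<nu> z) ?S' = 0"
        using S S' by (simp_all add: emeasure_\<nu>)
      then have "emeasure (\<nu> z) (S \<union> ?S') = 0"
        using S S' by (subst plus_emeasure[symmetric]) auto
      then show ?thesis by (simp add: emeasure_\<nu> G_UNIV z_def)
    qed
    then show ?thesis by (simp add: algebra_simps)
  qed
  have "G ?S' (T (G S x)) = 0"
    by (rule rinner_eqI) (metis cross S' proj_G proj_op_symmetric rinner.zero_left symmetricD)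
  moreover have "G S (T (G ?S' x)) = 0"
    by (rule rinner_eqI)
      (metis cross S proj_G proj_op_symmetric rinner.zero_left rinner_commute symmetricD symmetric_T)
  ultimately show ?thesis
    using decomp[of "T (G S x)"] decomp[of x]
    by (metis add.right_neutral blinfun.add_right)
qed

end

text \<open>Both \<open>E a\<close> and the projection \<open>H\<close> given by any spectral measure for the half-line up to
  \<open>a\<close> commute with \<open>T\<close>, hence with each other.  On a vector in the range of one and the kernel of
  the other, \<open>T\<close> would be at most \<open>a\<close> and at least \<open>a\<close>, with strictness in one of the two
  inequalities; so there is none but \<open>0\<close>.\<close>

lemma (in spectral_family) spectral_measure_atMost:
  assumes G': "spectral_measure T G'"
  shows "G' {..a} = E a"
proof -
  interpret R: spectral_resolution T G'
    by unfold_locales (rule bounded_op_T symmetric_T G')+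
  define H where "H = G' {..a}"
  have HE: "H (E a x) = E a (H x)" for x
    unfolding H_def
    by (rule commutes_E[OF commutes_star_symmetric[OF proj_op_symmetric[OF R.proj_G]]])
      (simp_all add: R.T_G)
  have H_idem: "H (H x) = H x" for x unfolding H_def by (rule proj_op_idem[OF R.proj_G]) simp
  have "E a (H x) = H x" for x
  proof -
    define z where "z = H x - E a (H x)"
    have Ez: "E a z = 0" by (simp add: z_def blinfun.diff_right E_idem)
    have "H z = z" by (simp add: z_def blinfun.diff_right HE H_idem)
    then have "AE t in R.\<nu> z. t \<in> {..a}" by (intro R.AE_\<nu>_in) (auto simp: H_def)
    then have "(\<integral>t. t \<partial>R.\<nu> z) \<le> (\<integral>t. a \<partial>R.\<nu> z)"
      by (intro integral_mono_AE R.integrable_id finite_measure.integrable_const R.finite_measure_\<nu>)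
        (auto elim: eventually_mono)
    also have "\<dots> = a * (norm z)\<^sup>2" by (simp add: R.measure_\<nu> R.G_UNIV)
    finally have "z = 0"
      using E_lower[OF Ez] E_strict[OF Ez] by (simp add: R.quadratic_eq_integral)
    then show ?thesis by (simp add: z_def)
  qed
  moreover have "H (E a x) = E a x" for x
  proof -
    define z where "z = E a x - H (E a x)"
    have "E a z = z" by (simp add: z_def blinfun.diff_right E_idem flip: HE)
    then have le: "rinner (T z) z \<le> a * (norm z)\<^sup>2" by (rule E_upper)
    have "H z = 0" by (simp add: z_def blinfun.diff_right H_idem)
    then have "emeasure (R.\<nu> z) {..a} = 0" by (simp add: R.emeasure_\<nu> H_def)
    then have "{..a} \<in> null_sets (R.\<nu> z)" by (simp add: null_sets_def)
    from AE_not_in[OF this] have gt: "AE t in R.\<nu> z. 0 < t - a" by eventually_elim auto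
    have int: "integrable (R.\<nu> z) (\<lambda>t. t - a)"
      by (intro Bochner_Integration.integrable_diff R.integrable_id
          finite_measure.integrable_const R.finite_measure_\<nu>)
    have "(\<integral>t. t - a \<partial>R.\<nu> z) = (\<integral>t. t \<partial>R.\<nu> z) - (\<integral>t. a \<partial>R.\<nu> z)"
      by (intro Bochner_Integration.integral_diff R.integrable_id
          finite_measure.integrable_const R.finite_measure_\<nu>)
    then have "(\<integral>t. t - a \<partial>R.\<nu> z) = rinner (T z) z - a * (norm z)\<^sup>2"
      by (simp add: R.quadratic_eq_integral R.measure_\<nu> R.G_UNIV)
    moreover have ge: "AE t in R.\<nu> z. 0 \<le> t - a" using gt by eventually_elim simp
    then have "0 \<le> (\<integral>t. t - a \<partial>R.\<nu> z)" by (rule integral_nonneg_AE)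
    ultimately have "(\<integral>t. t - a \<partial>R.\<nu> z) = 0" using le by simp
    then have "AE t in R.\<nu> z. t - a = 0"
      using integral_nonneg_eq_0_iff_AE[OF int ge] by simp
    with gt have "AE t in R.\<nu> z. False" by eventually_elim simp
    then have "emeasure (R.\<nu> z) UNIV = 0" by (simp add: AE_iff_measurable[OF _ refl])
    then show ?thesis by (simp add: R.emeasure_\<nu> R.G_UNIV z_def)
  qed
  ultimately show ?thesis by (intro blinfun_eqI) (metis HE H_def)
qed

lemma (in spectral_family) diagonal_measure_unique:
  assumes G': "spectral_measure T G'"
  shows "diagonal_measure G' x = \<mu> x"
proof -
  interpret R: spectral_resolution T G'
    by unfold_locales (rule bounded_op_T symmetric_T G')+
  have compl: "{a<..} = UNIV - {..a}" for a :: real by auto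
  have "measure (R.\<nu> x) {a<..} = measure (\<mu> x) {a<..}" for a
    using finite_measure.finite_measure_compl[OF R.finite_measure_\<nu>, of "{..a}" x]
    unfolding compl
    by (simp add: measure_\<mu>_compl measure_\<mu>_atMost R.measure_\<nu> R.G_UNIV
        spectral_measure_atMost[OF G'])
  then have "emeasure (R.\<nu> x) {a<..} = emeasure (\<mu> x) {a<..}" for a
    by (simp add: finite_measure.emeasure_eq_measure finite_measure_\<mu> R.finite_measure_\<nu>)
  then show ?thesis
    by (intro measure_eqI_lessThan)
      (simp_all add: finite_measure.emeasure_finite[OF finite_measure_\<mu>] less_top[symmetric])
qed


section \<open>The functional calculus of a positive operator\<close>

text \<open>The binary digits of \<open>\<phi>\<close> expand it into a series of indicator functions with absolutely
  summable coefficients; replacing the indicators by spectral projections gives a series of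
  operators that converges in norm.\<close>

lemma binary_expansion:
  fixes \<phi> :: "'a \<Rightarrow> real"
  assumes \<phi>: "\<And>t. 0 \<le> \<phi> t" "\<And>t. \<phi> t < 1"
  shows "(\<lambda>n. (1/2) ^ Suc n * indicat_real {t. odd \<lfloor>2 ^ Suc n * \<phi> t\<rfloor>} t) sums \<phi> t"
proof -
  have digit: "\<lfloor>2 * y\<rfloor> = 2 * \<lfloor>y\<rfloor> + of_bool (odd \<lfloor>2 * y\<rfloor>)" for y :: real
  proof -
    have "2 * \<lfloor>y\<rfloor> \<le> \<lfloor>2 * y\<rfloor>" "\<lfloor>2 * y\<rfloor> \<le> 2 * \<lfloor>y\<rfloor> + 1" by linarith+
    then have "\<lfloor>2 * y\<rfloor> = 2 * \<lfloor>y\<rfloor> \<or> \<lfloor>2 * y\<rfloor> = 2 * \<lfloor>y\<rfloor> + 1" by linarith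
    then show ?thesis by auto
  qed
  have partial: "(\<Sum>k<n. (1/2) ^ Suc k * indicat_real {t. odd \<lfloor>2 ^ Suc k * \<phi> t\<rfloor>} t) =
      \<lfloor>2 ^ n * \<phi> t\<rfloor> / 2 ^ n" for n
  proof (induction n)
    case 0
    have "\<lfloor>\<phi> t\<rfloor> = 0" using \<phi>[of t] by linarith
    then show ?case by simp
  next
    case (Suc n)
    have "real_of_int \<lfloor>2 ^ Suc n * \<phi> t\<rfloor> =
        2 * \<lfloor>2 ^ n * \<phi> t\<rfloor> + indicat_real {t. odd \<lfloor>2 ^ Suc n * \<phi> t\<rfloor>} t"
      using arg_cong[OF digit[of "2 ^ n * \<phi> t"], of real_of_int]
      by (simp add: indicator_def mult.assoc)
    then show ?case unfolding sum.lessThan_Suc Suc by (simp add: field_simps)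
  qed
  have "(\<lambda>n. \<lfloor>2 ^ n * \<phi> t\<rfloor> / 2 ^ n) \<longlonglongrightarrow> \<phi> t"
  proof (rule real_tendsto_sandwich)
    show "\<forall>\<^sub>F n in sequentially. \<phi> t - (1/2) ^ n \<le> \<lfloor>2 ^ n * \<phi> t\<rfloor> / 2 ^ n"
    proof (intro always_eventually allI)
      fix n
      have "2 ^ n * \<phi> t - 1 \<le> \<lfloor>2 ^ n * \<phi> t\<rfloor>" by linarith
      then have "(2 ^ n * \<phi> t - 1) / 2 ^ n \<le> \<lfloor>2 ^ n * \<phi> t\<rfloor> / 2 ^ n" by (rule divide_right_mono) simp
      then show "\<phi> t - (1/2) ^ n \<le> \<lfloor>2 ^ n * \<phi> t\<rfloor> / 2 ^ n" by (simp add: diff_divide_distrib power_divide)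
    qed
    show "\<forall>\<^sub>F n in sequentially. \<lfloor>2 ^ n * \<phi> t\<rfloor> / 2 ^ n \<le> \<phi> t"
      by (intro always_eventually allI) (simp add: divide_le_eq mult.commute)
    have "(\<lambda>n. \<phi> t - (1/2) ^ n) \<longlonglongrightarrow> \<phi> t - 0" by (intro tendsto_intros LIMSEQ_power_zero) simp
    then show "(\<lambda>n. \<phi> t - (1/2) ^ n) \<longlonglongrightarrow> \<phi> t" by simp
  qed simp
  then show ?thesis by (simp only: sums_def partial)
qed

lemma (in spectral_family) ex_integral_op:
  assumes [measurable]: "\<phi> \<in> borel_measurable borel" and \<phi>: "\<And>t. 0 \<le> \<phi> t" "\<And>t. \<phi> t < 1"
  shows "\<exists>B. bounded_op B \<and> symmetric B \<and> (\<forall>x. rinner (B x) x = (\<integral>t. \<phi> t \<partial>\<mu> x))"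
proof -
  define S where "S n = {t. odd \<lfloor>2 ^ Suc n * \<phi> t\<rfloor>}" for n
  have S [measurable]: "S n \<in> sets borel" for n unfolding S_def by measurable
  have G: "proj_op (G (S n))" "bounded_op (G (S n))" "measure (\<mu> x) (S n) = rinner (G (S n) x) x" for n x
    using represents_G[OF S, of n] by (auto simp: represents_def proj_op_quadratic)
  define g where "g n = (1/2) ^ Suc n *\<^sub>R G (S n)" for n
  have "norm (g n) \<le> (1/2) ^ Suc n" for n
  proof -
    have "norm (G (S n)) \<le> 1" by (rule norm_blinfun_bound) (simp_all add: proj_op_norm_le G)
    then show ?thesis by (simp add: g_def)
  qed
  moreover have geo: "summable (\<lambda>n. (1/2 :: real) ^ Suc n)" by (simp add: summable_Suc_iff)
  ultimately obtain B where B: "g sums B"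
    using summable_comparison_test'[OF geo] by (metis summable_def)
  then have partial: "(\<lambda>n. \<Sum>k<n. g k) \<longlonglongrightarrow> B" by (simp add: sums_def)
  have Bx: "(\<lambda>n. g n x) sums B x" for x
    by (rule bounded_linear.sums[OF blinfun.bounded_linear_left B])
  have "symmetric (\<Sum>k<n. g k)" for n
    by (induction n) (auto simp: g_def intro!: symmetric_add symmetric_scaleR proj_op_symmetric[OF G(1)])
  then have "symmetric B" by (rule symmetric_tendsto[OF partial])
  moreover have "bounded_op B"
    unfolding bounded_op_def
  proof (intro allI)
    fix c x
    have "(\<lambda>n. c *\<^sub>C g n x) sums (c *\<^sub>C B x)"
      by (rule bounded_linear.sums[OF bounded_linear_scaleC Bx])
    then show "B (c *\<^sub>C x) = c *\<^sub>C B x"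
      using Bx[of "c *\<^sub>C x"] sums_unique2
      by (simp add: g_def bounded_op_scaleC[OF bounded_op_scaleR[OF G(2)]])
  qed
  moreover have "rinner (B x) x = (\<integral>t. \<phi> t \<partial>\<mu> x)" for x
  proof -
    let ?f = "\<lambda>n t. (1/2) ^ Suc n * indicat_real (S n) t"
    have f_int: "integrable (\<mu> x) (?f n)" for n
      by (rule finite_measure.integrable_const_bound[OF finite_measure_\<mu>, where B = 1])
        (auto simp: indicator_def power_le_one simp del: power_Suc)
    have f_norm: "norm (?f n t) = ?f n t" for n t by simp
    have f_integral: "(\<integral>t. ?f n t \<partial>\<mu> x) = rinner (g n x) x" for n
      by (simp add: G(3) g_def blinfun.scaleR_left rinner.scaleR_left)
    have f_sums: "(\<lambda>n. ?f n t) sums \<phi> t" for t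
      unfolding S_def by (rule binary_expansion[OF \<phi>])
    have rg: "(\<lambda>n. rinner (g n x) x) sums rinner (B x) x"
      by (rule bounded_linear.sums[OF rinner.bounded_linear_left Bx])
    have "(\<lambda>n. \<integral>t. ?f n t \<partial>\<mu> x) sums (\<integral>t. (\<Sum>n. ?f n t) \<partial>\<mu> x)"
    proof (rule sums_integral[OF f_int])
      show "AE t in \<mu> x. summable (\<lambda>n. norm (?f n t))"
        unfolding f_norm using f_sums by (simp add: sums_iff)
      show "summable (\<lambda>n. \<integral>t. norm (?f n t) \<partial>\<mu> x)"
        unfolding f_norm f_integral using rg by (simp add: sums_iff)
    qed
    moreover have "(\<Sum>n. ?f n t) = \<phi> t" for t using f_sums by (simp add: sums_iff)
    ultimately show ?thesis using rg sums_unique2 unfolding f_integral by simp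
  qed
  ultimately show ?thesis by blast
qed

text \<open>Polarise the imaginary part of the form, which vanishes, at \<open>x, y\<close> and at \<open>x, \<i> y\<close>.\<close>

lemma symmetric_if_real:
  fixes B :: "'a::complex_hilbert_space endo"
  assumes B: "bounded_op B" and real: "\<And>x. cinner (B x) x = complex_of_real (q x)"
  shows "symmetric B"
  unfolding symmetric_def
proof (intro allI)
  fix x y
  have zero: "rinner (\<i> *\<^sub>C B x) x = 0" for x
    using arg_cong[OF real[of x], of Im] by (simp add: cinner_rinner)
  have anti: "rinner (\<i> *\<^sub>C B x) y = - rinner (\<i> *\<^sub>C B y) x" for x y
    using zero[of "x + y"] zero[of x] zero[of y]
    by (simp add: blinfun.add_right scaleC_add_right rinner.add_left rinner.add_right)
  have ii: "\<i> *\<^sub>C \<i> *\<^sub>C z = - z" for z :: 'a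
    by (simp add: scaleC_scaleC)
  have "rinner (\<i> *\<^sub>C B x) (\<i> *\<^sub>C y) = - rinner (\<i> *\<^sub>C B (\<i> *\<^sub>C y)) x" by (rule anti)
  also have "\<dots> = rinner (B y) x" by (simp add: bounded_op_scaleC[OF B] ii rinner.minus_left)
  also have "rinner (\<i> *\<^sub>C B x) (\<i> *\<^sub>C y) = rinner (B x) y"
    by (simp add: rinner_scaleC_left ii)
  finally show "rinner (B x) y = rinner x (B y)" by (simp add: rinner_commute)
qed

lemma (in spectral_family) fun_calc_eqI:
  assumes B: "bounded_op B" "symmetric B"
    and q: "\<And>x. rinner (B x) x = set_lebesgue_integral (\<mu> x) {0..} f"
  shows "fun_calc f T = B"
  unfolding fun_calc_def
proof (rule the_equality)
  show "bounded_op B \<and> (\<exists>E. spectral_measure T E \<and>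
      (\<forall>x. cinner (B x) x = complex_of_real (set_lebesgue_integral (diagonal_measure E x) {0..} f)))"
    using spectral_measure_G B by (auto simp: diagonal_measure_G symmetric_cinner q)
next
  fix B' assume "bounded_op B' \<and> (\<exists>E. spectral_measure T E \<and>
      (\<forall>x. cinner (B' x) x = complex_of_real (set_lebesgue_integral (diagonal_measure E x) {0..} f)))"
  then have B': "bounded_op B'"
    and q': "\<And>x. cinner (B' x) x = complex_of_real (set_lebesgue_integral (\<mu> x) {0..} f)"
    using diagonal_measure_unique by auto
  show "B' = B"
  proof (rule symmetric_eqI)
    show "symmetric B'" by (rule symmetric_if_real[OF B' q'])
    show "rinner (B' x) x = rinner (B x) x" for x
      using q'[of x] by (simp add: rinner_def q[unfolded rinner_def])
  qed (rule B)
qed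

text \<open>All that is needed about \<open>f(T)\<close> are its bounds by affine functions of \<open>T\<close>, inherited from
  bounds of \<open>f\<close> on the interval that contains the spectrum.\<close>

lemma fun_calc_affine_bounds:
  fixes T :: "'a::complex_hilbert_space endo"
  assumes T: "positive_op T" and f: "mono_on {0..} f" "\<forall>t\<ge>0. 0 \<le> f t"
  shows "symmetric (fun_calc f T)"
    and "(\<And>t. 0 \<le> t \<Longrightarrow> t \<le> norm T \<Longrightarrow> f t \<le> a * t + b) \<Longrightarrow>
      rinner (fun_calc f T x) x \<le> a * rinner (T x) x + b * (norm x)\<^sup>2"
    and "(\<And>t. 0 \<le> t \<Longrightarrow> t \<le> norm T \<Longrightarrow> a * t + b \<le> f t) \<Longrightarrow>
      a * rinner (T x) x + b * (norm x)\<^sup>2 \<le> rinner (fun_calc f T x) x"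
proof -
  obtain E where "spectral_family T E"
    using ex_spectral_family[of T] T by (auto simp: positive_op_iff)
  then interpret spectral_family T E .
  define M where "M = norm T"
  have M: "0 \<le> M" by (simp add: M_def)
  have supp: "AE t in \<mu> x. t \<in> {0..M}" for x
    using AE_\<mu>_bounds[of 0 M x] T T_upper by (auto simp: positive_op_iff M_def)
  define k where "k = f M + 1"
  have k: "k > 0" using f(2) M by (simp add: k_def add_nonneg_pos)
  define h where "h t = indicat_real {0..M} t * f (max 0 t)" for t
  have h_eq: "h t = f t" if "t \<in> {0..M}" for t using that by (simp add: h_def)
  have "mono (\<lambda>t. f (max 0 t))" using f(1) by (auto simp: mono_def mono_on_def)
  then have [measurable]: "(\<lambda>t. f (max 0 t)) \<in> borel_measurable borel" by (rule borel_measurable_mono)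
  have h_meas [measurable]: "h \<in> borel_measurable borel" unfolding h_def by measurable
  have h0: "0 \<le> h t" for t using f(2) by (simp add: h_def)
  have hM: "h t \<le> f M" for t
    using f M by (auto simp: h_def indicator_def mono_on_def)
  have "\<exists>B. bounded_op B \<and> symmetric B \<and> (\<forall>x. rinner (B x) x = (\<integral>t. h t / k \<partial>\<mu> x))"
    using h0 k le_less_trans[OF hM, of k] by (intro ex_integral_op) (auto simp: k_def)
  then obtain B where B: "bounded_op B" "symmetric B" "\<And>x. rinner (B x) x = (\<integral>t. h t / k \<partial>\<mu> x)" by blast
  have kB: "rinner ((k *\<^sub>R B) x) x = (\<integral>t. h t \<partial>\<mu> x)" for x
    using k by (simp add: blinfun.scaleR_left rinner.scaleR_left B(3))
  have eq: "fun_calc f T = k *\<^sub>R B"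
  proof (rule fun_calc_eqI)
    fix x
    have "(\<integral>t. h t \<partial>\<mu> x) = set_lebesgue_integral (\<mu> x) {0..} f"
      unfolding set_lebesgue_integral_def
    proof (rule integral_cong_AE)
      have "(\<lambda>t. indicat_real {0..} t *\<^sub>R f t) = (\<lambda>t. indicat_real {0..} t *\<^sub>R f (max 0 t))"
        by (auto simp: indicator_def)
      then show "(\<lambda>t. indicat_real {0..} t *\<^sub>R f t) \<in> borel_measurable (\<mu> x)" by simp
      show "AE t in \<mu> x. h t = indicat_real {0..} t *\<^sub>R f t"
        using supp by eventually_elim (simp add: h_eq)
    qed measurable
    then show "rinner ((k *\<^sub>R B) x) x = set_lebesgue_integral (\<mu> x) {0..} f" by (simp add: kB)
  qed (simp_all add: bounded_op_scaleR symmetric_scaleR B)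
  show "symmetric (fun_calc f T)" by (simp add: eq symmetric_scaleR B)
  have q: "rinner (fun_calc f T x) x = (\<integral>t. h t \<partial>\<mu> x)" by (simp add: eq kB)
  have int_h: "integrable (\<mu> x) h"
    by (rule finite_measure.integrable_const_bound[OF finite_measure_\<mu>, where B = "f M"])
      (use h0 hM in auto)
  have int_id: "integrable (\<mu> x) (\<lambda>t. t)"
    by (rule finite_measure.integrable_const_bound[OF finite_measure_\<mu>, where B = M])
      (use supp[of x] in \<open>auto elim: eventually_mono\<close>)
  have int_const: "integrable (\<mu> x) (\<lambda>t. c)" for c :: real
    by (rule finite_measure.integrable_const[OF finite_measure_\<mu>])
  have int_aff: "integrable (\<mu> x) (\<lambda>t. a * t + b)"
    by (intro Bochner_Integration.integrable_add integrable_mult_right int_id int_const)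
  have "(\<integral>t. a * t + b \<partial>\<mu> x) = (\<integral>t. a * t \<partial>\<mu> x) + (\<integral>t. b \<partial>\<mu> x)"
    by (intro Bochner_Integration.integral_add integrable_mult_right int_id int_const)
  then have aff: "(\<integral>t. a * t + b \<partial>\<mu> x) = a * rinner (T x) x + b * (norm x)\<^sup>2"
    by (simp add: quadratic_eq_integral measure_\<mu>_UNIV)
  show "rinner (fun_calc f T x) x \<le> a * rinner (T x) x + b * (norm x)\<^sup>2"
    if "\<And>t. 0 \<le> t \<Longrightarrow> t \<le> norm T \<Longrightarrow> f t \<le> a * t + b"
    unfolding q aff[symmetric]
    by (rule integral_mono_AE[OF int_h int_aff])
      (use supp[of x] in \<open>eventually_elim, use that h_eq in \<open>auto simp: M_def\<close>\<close>)
  show "a * rinner (T x) x + b * (norm x)\<^sup>2 \<le> rinner (fun_calc f T x) x"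
    if "\<And>t. 0 \<le> t \<Longrightarrow> t \<le> norm T \<Longrightarrow> a * t + b \<le> f t"
    unfolding q aff[symmetric]
    by (rule integral_mono_AE[OF int_aff int_h])
      (use supp[of x] in \<open>eventually_elim, use that h_eq in \<open>auto simp: M_def\<close>\<close>)
qed


section \<open>Convex and concave functions on the half-line\<close>

lemma concave_nonneg_mono:
  fixes f :: "real \<Rightarrow> real"
  assumes f: "concave_on {0..} f" and nonneg: "\<forall>t\<ge>0. 0 \<le> f t"
  shows "mono_on {0..} f"
proof (rule mono_onI, rule ccontr)
  fix s t assume st: "s \<in> {0..}" "t \<in> {0..}" "s \<le> t" and "\<not> f s \<le> f t"
  then have less: "f t < f s" by simp
  then have "s \<noteq> t" by auto
  have fs: "0 < f s" using less nonneg st by (metis atLeast_iff le_less_trans)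
  \<comment> \<open>The chord from \<open>s\<close> through \<open>t\<close> reaches half the loss \<open>f s - f t\<close> at \<open>t\<close> if its other
    end, where \<open>f \<ge> 0\<close>, lies at \<open>u\<close>.\<close>
  define l where "l = (f s - f t) / (2 * f s)"
  have l: "0 < l" "l \<le> 1" using less fs nonneg st by (simp_all add: l_def field_simps)
  define u where "u = s + (t - s) / l"
  have u: "0 \<le> u" using st l by (simp add: u_def)
  have "(1 - l) *\<^sub>R s + l *\<^sub>R u = t" using l by (simp add: u_def field_simps)
  then have "(1 - l) * f s + l * f u \<le> f t"
    using concave_onD[OF f, of l s u] l st u by simp
  moreover have "0 \<le> l * f u" using l nonneg u by simp
  moreover have "(1 - l) * f s = f s - (f s - f t) / 2" using fs by (simp add: l_def field_simps)
  ultimately show False using less by argo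
qed

lemma concave_ge_chord:
  fixes f :: "real \<Rightarrow> real"
  assumes f: "concave_on {0..} f" and f0: "0 \<le> f 0" and t: "0 \<le> t" "t \<le> M" "0 < M"
  shows "f M / M * t \<le> f t"
proof -
  have "(1 - t / M) *\<^sub>R 0 + (t / M) *\<^sub>R M = t" using t by simp
  then have "(1 - t / M) * f 0 + t / M * f M \<le> f t"
    using concave_onD[OF f, of "t / M" 0 M] t by simp
  moreover have "0 \<le> (1 - t / M) * f 0" using t f0 by simp
  moreover have "f M / M * t = t / M * f M" by simp
  ultimately show ?thesis by linarith
qed

lemma convex_le_chord:
  fixes g :: "real \<Rightarrow> real"
  assumes g: "convex_on {0..} g" and g0: "g 0 = 0" and t: "0 \<le> t" "t \<le> M"
  shows "g t \<le> g M / M * t"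
proof (cases "M = 0")
  case False
  have "g ((1 - t / M) *\<^sub>R 0 + (t / M) *\<^sub>R M) \<le> (1 - t / M) * g 0 + t / M * g M"
    using convex_onD[OF g, of "t / M" 0 M] t False by simp
  then show ?thesis using t False g0 by (simp add: mult.commute)
qed (use t g0 in simp)

lemma convex_nonneg_mono:
  fixes g :: "real \<Rightarrow> real"
  assumes g: "convex_on {0..} g" and nonneg: "\<forall>t\<ge>0. 0 \<le> g t" and g0: "g 0 = 0"
  shows "mono_on {0..} g"
proof (rule mono_onI)
  fix s t :: real assume st: "s \<in> {0..}" "t \<in> {0..}" "s \<le> t"
  have "g s \<le> g t / t * s" using st by (intro convex_le_chord[OF g g0]) auto
  also have "\<dots> \<le> g t"
  proof (cases "t = 0")
    case False
    then show ?thesis using st nonneg by (simp add: divide_le_eq mult_left_mono)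
  qed (use nonneg in simp)
  finally show "g s \<le> g t" .
qed

lemma ex_supporting_line:
  fixes g :: "real \<Rightarrow> real"
  assumes g: "convex_on {0..} g" and M: "0 < M"
  shows "\<exists>c. \<forall>t\<ge>0. g M + c * (t - M) \<le> g t"
  using convex_le_Inf_differential[OF g, of M] M by (auto simp: interior_real_atLeast)

lemma powr_convex_on_atLeast0:
  assumes p: "1 \<le> p"
  shows "convex_on {0..} (\<lambda>t::real. t powr p)"
proof (rule convex_on_linorderI)
  fix t x y :: real assume t: "0 < t" "t < 1" and xy: "x \<in> {0..}" "y \<in> {0..}" "x < y"
  show "((1 - t) *\<^sub>R x + t *\<^sub>R y) powr p \<le> (1 - t) * x powr p + t * y powr p"
  proof (cases "x = 0")
    case True
    have "t powr p \<le> t powr 1" using p t by (intro powr_mono') auto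
    then have "t powr p * y powr p \<le> t * y powr p" using t by (intro mult_right_mono) auto
    then show ?thesis using True t xy p by (simp add: powr_mult)
  next
    case False
    then show ?thesis using convex_onD[OF powr_convex[OF p], of t x y] t xy by simp
  qed
qed simp


section \<open>Congruences by expansive operators\<close>

lemma norm_le_expansive:
  assumes Z: "bounded_op Z" "expansive Z"
  shows "norm x \<le> norm (Z x)"
proof -
  have "0 \<le> rinner (((adj Z o\<^sub>L Z) - id_blinfun) x) x"
    using Z(2) by (simp add: expansive_def positive_op_iff)
  then have "(norm x)\<^sup>2 \<le> (norm (Z x))\<^sup>2"
    by (simp add: blinfun.diff_left rinner.diff_left rinner_adj_left[OF Z(1)] rinner_self)
  then show ?thesis by (rule power2_le_imp_le) simp
qed

lemma bounded_op_adj: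
  assumes "bounded_op T"
  shows "bounded_op (adj T)"
  unfolding bounded_op_def
proof (intro allI rinner_eqI)
  fix c x z
  show "rinner (adj T (c *\<^sub>C x)) z = rinner (c *\<^sub>C adj T x) z"
    by (simp add: rinner_adj_left[OF assms] rinner_scaleC_left bounded_op_scaleC[OF assms])
qed

lemma rinner_congruence_sum:
  assumes "\<And>i. i \<in> I \<Longrightarrow> bounded_op (Z i)"
  shows "rinner ((\<Sum>i\<in>I. adj (Z i) o\<^sub>L B i o\<^sub>L Z i) x) y = (\<Sum>i\<in>I. rinner (B i (Z i x)) (Z i y))"
  by (simp add: blinfun.sum_left rinner.sum_left rinner_adj_left assms cong: sum.cong)

lemma symmetric_congruence_sum:
  assumes Z: "\<And>i. i \<in> I \<Longrightarrow> bounded_op (Z i)" and B: "\<And>i. i \<in> I \<Longrightarrow> symmetric (B i)"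
  shows "symmetric (\<Sum>i\<in>I. adj (Z i) o\<^sub>L B i o\<^sub>L Z i)"
proof -
  let ?Q = "\<Sum>i\<in>I. adj (Z i) o\<^sub>L B i o\<^sub>L Z i"
  have form: "rinner (?Q x) y = (\<Sum>i\<in>I. rinner (B i (Z i x)) (Z i y))" for x y
    by (rule rinner_congruence_sum[OF Z])
  have "rinner (?Q x) y = rinner (?Q y) x" for x y
    unfolding form by (rule sum.cong[OF refl]) (metis B rinner_commute symmetricD)
  then show ?thesis by (simp add: symmetric_def rinner_commute)
qed

lemma positive_congruence_sum:
  assumes Z: "\<And>i. i \<in> I \<Longrightarrow> bounded_op (Z i)" and A: "\<And>i. i \<in> I \<Longrightarrow> positive_op (A i)"
  shows "positive_op (\<Sum>i\<in>I. adj (Z i) o\<^sub>L A i o\<^sub>L Z i)"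
  unfolding positive_op_iff
proof (intro conjI allI)
  show "bounded_op (\<Sum>i\<in>I. adj (Z i) o\<^sub>L A i o\<^sub>L Z i)"
    using assms
    by (induction I rule: infinite_finite_induct)
      (auto intro!: bounded_op_add bounded_op_compose bounded_op_adj simp: positive_op_iff)
  have "symmetric (A i)" if "i \<in> I" for i using A[OF that] by (simp add: positive_op_iff)
  then show "symmetric (\<Sum>i\<in>I. adj (Z i) o\<^sub>L A i o\<^sub>L Z i)"
    by (intro symmetric_congruence_sum Z)
  show "0 \<le> rinner ((\<Sum>i\<in>I. adj (Z i) o\<^sub>L A i o\<^sub>L Z i) x) x" for x
    using assms by (simp add: rinner_congruence_sum sum_nonneg positive_op_iff)
qed

text \<open>Every vector \<open>x\<close> is some \<open>Z w\<close> with \<open>\<parallel>w\<parallel> \<le> \<parallel>x\<parallel>\<close>, so the form of \<open>A\<close> is bounded by that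
  of the congruent operators.\<close>

lemma norm_le_norm_congruence_sum:
  fixes A Z :: "'i \<Rightarrow> 'a::complex_hilbert_space endo"
  assumes I: "finite I" "i \<in> I"
    and A: "\<And>i. i \<in> I \<Longrightarrow> positive_op (A i)" and Z: "\<And>i. i \<in> I \<Longrightarrow> bounded_op (Z i)"
    and exp: "expansive (Z i)" and inv: "invertible_op (Z i)"
  shows "norm (A i) \<le> norm (\<Sum>i\<in>I. adj (Z i) o\<^sub>L A i o\<^sub>L Z i)" (is "_ \<le> norm ?S")
proof (rule symmetric_norm_le)
  fix x
  obtain W where W: "Z i o\<^sub>L W = id_blinfun" using inv by (auto simp: invertible_op_def)
  define w where "w = W x"
  have x: "x = Z i w"
    using arg_cong[OF W, of "\<lambda>T. blinfun_apply T x"] by (simp add: w_def)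
  have pos: "0 \<le> rinner (A j y) y" if "j \<in> I" for j y using A[OF that] by (simp add: positive_op_iff)
  have "rinner (A i x) x \<le> (\<Sum>j\<in>I. rinner (A j (Z j w)) (Z j w))"
    unfolding x using I pos by (intro member_le_sum[of i I "\<lambda>j. rinner (A j (Z j w)) (Z j w)"]) auto
  also have "\<dots> = rinner (?S w) w" by (simp add: rinner_congruence_sum Z)
  also have "\<dots> \<le> norm ?S * (norm w)\<^sup>2" using abs_rinner_le[of ?S w] by simp
  also have "\<dots> \<le> norm ?S * (norm x)\<^sup>2"
    unfolding x using norm_le_expansive[OF Z[OF I(2)] exp] by (intro mult_left_mono power_mono) auto
  finally show "\<bar>rinner (A i x) x\<bar> \<le> norm ?S * (norm x)\<^sup>2" using pos[OF I(2)] by simp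
qed (use A[OF I(2)] in \<open>simp_all add: positive_op_iff\<close>)


section \<open>The norm inequalities\<close>

context
  fixes I :: "'i set" and A Z :: "'i \<Rightarrow> 'a::complex_hilbert_space endo" and S
  assumes finite: "finite I"
    and A: "\<And>i. i \<in> I \<Longrightarrow> positive_op (A i)" and Z: "\<And>i. i \<in> I \<Longrightarrow> bounded_op (Z i)"
    and exp: "\<And>i. i \<in> I \<Longrightarrow> expansive (Z i)" and inv: "\<And>i. i \<in> I \<Longrightarrow> invertible_op (Z i)"
  defines "S \<equiv> \<Sum>i\<in>I. adj (Z i) o\<^sub>L A i o\<^sub>L Z i"
begin

lemma positive_S: "positive_op S"
  unfolding S_def by (rule positive_congruence_sum[OF Z A])

lemma form_S: "rinner (S x) x = (\<Sum>i\<in>I. rinner (A i (Z i x)) (Z i x))"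
  unfolding S_def by (rule rinner_congruence_sum[OF Z])

lemma norm_A_le: "i \<in> I \<Longrightarrow> norm (A i) \<le> norm S"
  unfolding S_def by (rule norm_le_norm_congruence_sum[OF finite _ A Z exp inv])

lemma form_S_le: "rinner (S x) x \<le> norm S * (norm x)\<^sup>2"
  using abs_rinner_le[of S x] by simp

text \<open>The congruent sum of the \<open>f(A\<^sub>i)\<close> dominates \<open>f M / M\<close> times \<open>S\<close>, where \<open>M = \<parallel>S\<parallel>\<close>, because
  \<open>f\<close> lies above its chord on \<open>[0, M]\<close>; the norm of the latter operator is \<open>f M\<close>.  For \<open>M = 0\<close>
  there is no chord, and expansiveness gives the lower bound \<open>f 0\<close> at any nonzero vector.\<close>

lemma concave_norm_le:
  fixes x0 :: 'a
  assumes I: "I \<noteq> {}" and x0: "x0 \<noteq> 0"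
    and f: "concave_on {0..} f" and f0: "\<forall>t\<ge>0. 0 \<le> f t"
  shows "norm (fun_calc f S) \<le> norm (\<Sum>i\<in>I. adj (Z i) o\<^sub>L fun_calc f (A i) o\<^sub>L Z i)"
    (is "_ \<le> norm ?Q")
proof -
  define M where "M = norm S"
  have M: "0 \<le> M" by (simp add: M_def)
  note mono = concave_nonneg_mono[OF f f0]
  note bounds_S = fun_calc_affine_bounds[OF positive_S mono f0]
  note bounds_A = fun_calc_affine_bounds[OF A mono f0]
  have "norm (fun_calc f S) \<le> f M"
  proof (rule symmetric_norm_le)
    fix x
    have "rinner (fun_calc f S x) x \<le> 0 * rinner (S x) x + f M * (norm x)\<^sup>2"
      using mono by (intro bounds_S(2)) (auto simp: mono_on_def M_def)
    moreover have "0 * rinner (S x) x + 0 * (norm x)\<^sup>2 \<le> rinner (fun_calc f S x) x"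
      using f0 by (intro bounds_S(3)) simp
    ultimately show "\<bar>rinner (fun_calc f S x) x\<bar> \<le> f M * (norm x)\<^sup>2" by simp
  qed (use bounds_S(1) f0 M in auto)
  also have "f M \<le> norm ?Q"
  proof (cases "M = 0")
    case True
    obtain i where i: "i \<in> I" using I by blast
    have ge: "f 0 * (norm (Z j x0))\<^sup>2 \<le> rinner (fun_calc f (A j) (Z j x0)) (Z j x0)" if "j \<in> I" for j
      using bounds_A(3)[OF that, of 0 "f 0" "Z j x0"] mono by (auto simp: mono_on_def)
    have "f 0 * (norm x0)\<^sup>2 \<le> f 0 * (norm (Z i x0))\<^sup>2"
      using norm_le_expansive[OF Z exp, OF i i] f0 by (intro mult_left_mono power_mono) auto
    also have "\<dots> \<le> rinner (fun_calc f (A i) (Z i x0)) (Z i x0)" by (rule ge[OF i])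
    also have "\<dots> \<le> (\<Sum>j\<in>I. rinner (fun_calc f (A j) (Z j x0)) (Z j x0))"
    proof (rule member_le_sum[OF i _ finite])
      fix j assume "j \<in> I - {i}"
      then have "f 0 * (norm (Z j x0))\<^sup>2 \<le> rinner (fun_calc f (A j) (Z j x0)) (Z j x0)"
        by (intro ge) simp
      moreover have "0 \<le> f 0 * (norm (Z j x0))\<^sup>2" using f0 by simp
      ultimately show "0 \<le> rinner (fun_calc f (A j) (Z j x0)) (Z j x0)" by linarith
    qed
    also have "\<dots> = rinner (?Q x0) x0" by (rule rinner_congruence_sum[OF Z, symmetric])
    also have "\<dots> \<le> norm ?Q * (norm x0)\<^sup>2" using abs_rinner_le[of ?Q x0] by simp
    finally show ?thesis using x0 True by simp
  next
    case False
    then have "0 < M" using M by simp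
    have c: "0 \<le> f M / M" using f0 M by simp
    have "norm ((f M / M) *\<^sub>R S) \<le> norm ?Q"
    proof (rule symmetric_norm_le)
      fix x
      have "f M / M * rinner (S x) x = (\<Sum>i\<in>I. f M / M * rinner (A i (Z i x)) (Z i x))"
        by (simp add: form_S sum_distrib_left)
      also have "\<dots> \<le> (\<Sum>i\<in>I. rinner (fun_calc f (A i) (Z i x)) (Z i x))"
      proof (rule sum_mono)
        fix i assume i: "i \<in> I"
        have "f M / M * t + 0 \<le> f t" if "0 \<le> t" "t \<le> norm (A i)" for t
          using concave_ge_chord[OF f _ that(1) _ \<open>0 < M\<close>] f0 that(2) norm_A_le[OF i] by (simp add: M_def)
        from bounds_A(3)[OF i this, of "Z i x"]
        show "f M / M * rinner (A i (Z i x)) (Z i x) \<le> rinner (fun_calc f (A i) (Z i x)) (Z i x)" by simp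
      qed
      also have "\<dots> = rinner (?Q x) x" by (rule rinner_congruence_sum[OF Z, symmetric])
      also have "\<dots> \<le> norm ?Q * (norm x)\<^sup>2" using abs_rinner_le[of ?Q x] by simp
      finally have "f M / M * rinner (S x) x \<le> norm ?Q * (norm x)\<^sup>2" .
      moreover have "0 \<le> f M / M * rinner (S x) x"
        using c positive_S by (intro mult_nonneg_nonneg) (auto simp: positive_op_iff)
      ultimately show "\<bar>rinner (((f M / M) *\<^sub>R S) x) x\<bar> \<le> norm ?Q * (norm x)\<^sup>2"
        by (simp only: blinfun.scaleR_left rinner.scaleR_left real_scaleR_def abs_of_nonneg)
    qed (use positive_S in \<open>auto simp: positive_op_iff symmetric_scaleR\<close>)
    then show ?thesis using c False M by (simp add: M_def)
  qed
  finally show ?thesis .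
qed

text \<open>The chord now gives the upper bound \<open>g M\<close> for the congruent sum.  That \<open>\<parallel>g(S)\<parallel> \<ge> g M\<close>
  follows from a supporting line \<open>g M + k (t - M)\<close> of \<open>g\<close> at \<open>M\<close>: the form of
  \<open>g(S)\<close> is at least that of \<open>g M + k (S - M)\<close>, which comes close to \<open>g M\<close> where the form of
  \<open>S\<close> comes close to \<open>M\<close>.\<close>

lemma convex_norm_le:
  assumes g: "convex_on {0..} g" and g0: "\<forall>t\<ge>0. 0 \<le> g t" "g 0 = 0"
  shows "norm (\<Sum>i\<in>I. adj (Z i) o\<^sub>L fun_calc g (A i) o\<^sub>L Z i) \<le> norm (fun_calc g S)"
    (is "norm ?Q \<le> _")
proof -
  define M where "M = norm S"
  have M: "0 \<le> M" by (simp add: M_def)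
  have c: "0 \<le> g M / M" using g0 M by simp
  note mono = convex_nonneg_mono[OF g g0]
  note bounds_S = fun_calc_affine_bounds[OF positive_S mono g0(1)]
  note bounds_A = fun_calc_affine_bounds[OF A mono g0(1)]
  have "norm ?Q \<le> g M"
  proof (rule symmetric_norm_le)
    fix x
    have form: "rinner (?Q x) x = (\<Sum>i\<in>I. rinner (fun_calc g (A i) (Z i x)) (Z i x))"
      by (rule rinner_congruence_sum[OF Z])
    also have "\<dots> \<le> (\<Sum>i\<in>I. g M / M * rinner (A i (Z i x)) (Z i x))"
    proof (rule sum_mono)
      fix i assume i: "i \<in> I"
      have "g t \<le> g M / M * t + 0" if "0 \<le> t" "t \<le> norm (A i)" for t
        using convex_le_chord[OF g g0(2) that(1)] that(2) norm_A_le[OF i] by (simp add: M_def)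
      from bounds_A(2)[OF i this, of "Z i x"]
      show "rinner (fun_calc g (A i) (Z i x)) (Z i x) \<le> g M / M * rinner (A i (Z i x)) (Z i x)" by simp
    qed
    also have "\<dots> = g M / M * rinner (S x) x" by (simp add: form_S sum_distrib_left)
    also have "\<dots> \<le> g M / M * (M * (norm x)\<^sup>2)"
      using form_S_le c unfolding M_def by (intro mult_left_mono)
    also have "\<dots> = g M * (norm x)\<^sup>2" using g0(2) by (cases "M = 0") auto
    finally have "rinner (?Q x) x \<le> g M * (norm x)\<^sup>2" .
    moreover have "0 \<le> rinner (?Q x) x"
    proof -
      have "0 \<le> rinner (fun_calc g (A i) y) y" if "i \<in> I" for i y
        using bounds_A(3)[OF that, of 0 0 y] g0(1) by simp
      then show ?thesis unfolding form by (intro sum_nonneg)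
    qed
    ultimately show "\<bar>rinner (?Q x) x\<bar> \<le> g M * (norm x)\<^sup>2" by simp
  qed (use g0 M symmetric_congruence_sum[OF Z bounds_A(1)] in auto)
  also have "g M \<le> norm (fun_calc g S)"
  proof (cases "M = 0")
    case False
    then have "0 < M" using M by simp
    obtain k where k: "\<And>t. 0 \<le> t \<Longrightarrow> g M + k * (t - M) \<le> g t"
      using ex_supporting_line[OF g \<open>0 < M\<close>] by blast
    define d where "d = norm (fun_calc g S) - g M + k * M"
    have le: "k * rinner (S x) x \<le> d * (norm x)\<^sup>2" for x
    proof -
      have "k * rinner (S x) x + (g M - k * M) * (norm x)\<^sup>2 \<le> rinner (fun_calc g S x) x"
        using k by (intro bounds_S(3)) (auto simp: algebra_simps)
      also have "\<dots> \<le> norm (fun_calc g S) * (norm x)\<^sup>2" using abs_rinner_le[of "fun_calc g S" x] by simp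
      finally show ?thesis by (simp add: d_def algebra_simps)
    qed
    show ?thesis
    proof (cases "g M \<le> 0")
      case True
      then show ?thesis using norm_ge_zero[of "fun_calc g S"] by linarith
    next
      case False
      then have "0 < k * M" using k[of 0] g0(2) by simp
      then have "0 < k" using \<open>0 < M\<close> zero_less_mult_pos2 by blast
      have "S \<noteq> 0" using \<open>0 < M\<close> by (auto simp: M_def)
      then obtain y where "S y \<noteq> 0" by (metis blinfun_eqI zero_blinfun.rep_eq)
      then have y: "0 < (norm y)\<^sup>2" by (metis blinfun.zero_right norm_eq_zero zero_less_power2)
      have pos: "0 \<le> k * rinner (S x) x" for x
        using positive_S \<open>0 < k\<close> by (simp add: positive_op_iff)
      have "0 \<le> d" using order_trans[OF pos le, of y] y by (simp add: zero_le_mult_iff)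
      have "norm (k *\<^sub>R S) \<le> d"
        using positive_S \<open>0 \<le> d\<close> le pos
        by (intro symmetric_norm_le)
          (auto simp: positive_op_iff symmetric_scaleR blinfun.scaleR_left rinner.scaleR_left)
      then show ?thesis using \<open>0 < k\<close> by (simp add: M_def d_def)
    qed
  qed (simp add: g0)
  finally show ?thesis .
qed

end

theorem mainTheorem4:
  fixes m :: nat
    and A Z :: "nat \<Rightarrow> 'a::complex_hilbert_space \<Rightarrow>\<^sub>L 'a"
  assumes inf_dim: "\<not> (\<exists>S::'a set. finite S \<and> complex_vector.span S = UNIV)"
    and m: "m \<ge> 1"
    and A_pos: "\<And>i. i \<in> {1..m} \<Longrightarrow> positive_op (A i)"
    and Z_bdd: "\<And>i. i \<in> {1..m} \<Longrightarrow> bounded_op (Z i)"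
    and Z_exp: "\<And>i. i \<in> {1..m} \<Longrightarrow> expansive (Z i)"
    and Z_inv: "\<And>i. i \<in> {1..m} \<Longrightarrow> invertible_op (Z i)"
  shows "(\<forall>f :: real \<Rightarrow> real. concave_on {0..} f \<and> (\<forall>t\<ge>0. 0 \<le> f t) \<longrightarrow>
            norm (fun_calc f (\<Sum>i=1..m. adj (Z i) o\<^sub>L A i o\<^sub>L Z i))
              \<le> norm (\<Sum>i=1..m. adj (Z i) o\<^sub>L fun_calc f (A i) o\<^sub>L Z i)) \<and>
         (\<forall>g :: real \<Rightarrow> real. convex_on {0..} g \<and> (\<forall>t\<ge>0. 0 \<le> g t) \<and> g 0 = 0 \<longrightarrow>
            norm (\<Sum>i=1..m. adj (Z i) o\<^sub>L fun_calc g (A i) o\<^sub>L Z i)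
              \<le> norm (fun_calc g (\<Sum>i=1..m. adj (Z i) o\<^sub>L A i o\<^sub>L Z i))) \<and>
         (\<forall>p :: real. p > 1 \<longrightarrow>
            norm (\<Sum>i=1..m. adj (Z i) o\<^sub>L fun_calc (\<lambda>t. t powr p) (A i) o\<^sub>L Z i)
              \<le> norm (fun_calc (\<lambda>t. t powr p) (\<Sum>i=1..m. adj (Z i) o\<^sub>L A i o\<^sub>L Z i)))"
proof (intro conjI allI impI)
  fix f :: "real \<Rightarrow> real" assume f: "concave_on {0..} f \<and> (\<forall>t\<ge>0. 0 \<le> f t)"
  obtain x0 :: 'a where "x0 \<noteq> 0"
    using inf_dim complex_vector.span_empty by (metis UNIV_eq_I finite.emptyI singletonI)
  then show "norm (fun_calc f (\<Sum>i=1..m. adj (Z i) o\<^sub>L A i o\<^sub>L Z i))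
      \<le> norm (\<Sum>i=1..m. adj (Z i) o\<^sub>L fun_calc f (A i) o\<^sub>L Z i)"
    using f m A_pos Z_bdd Z_exp Z_inv by (intro concave_norm_le) auto
next
  fix g :: "real \<Rightarrow> real" assume "convex_on {0..} g \<and> (\<forall>t\<ge>0. 0 \<le> g t) \<and> g 0 = 0"
  then show "norm (\<Sum>i=1..m. adj (Z i) o\<^sub>L fun_calc g (A i) o\<^sub>L Z i)
      \<le> norm (fun_calc g (\<Sum>i=1..m. adj (Z i) o\<^sub>L A i o\<^sub>L Z i))"
    using A_pos Z_bdd Z_exp Z_inv by (intro convex_norm_le) auto
next
  fix p :: real assume "p > 1"
  then show "norm (\<Sum>i=1..m. adj (Z i) o\<^sub>L fun_calc (\<lambda>t. t powr p) (A i) o\<^sub>L Z i)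
      \<le> norm (fun_calc (\<lambda>t. t powr p) (\<Sum>i=1..m. adj (Z i) o\<^sub>L A i o\<^sub>L Z i))"
    using A_pos Z_bdd Z_exp Z_inv
    by (intro convex_norm_le powr_convex_on_atLeast0) auto
qed

end
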